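(* Let $X$ and $Y$ be second countable compact Hausdorff spaces, $H$ a Hilbert space, and $E:\mathfrak{A}_X\to\mathcal{B}(H)$ and $F:\mathfrak{A}_Y\to\mathcal{B}(H)$ quantum probability measures with commuting ranges. Then there exists a unique quantum probability measure $E\cdot F:\mathfrak{A}_X\otimes\mathfrak{A}_Y\to\mathcal{B}(H)$ such that $$(E\cdot F)(\delta\times\theta)=E(\delta)F(\theta),\qquad \delta\in\mathfrak{A}_X,\ \theta\in\mathfrak{A}_Y.$$ Moreover, if $E$ and $F$ are spectral measures, then $E\cdot F$ is a spectral measure.
   Context: $\mathfrak{A}_X$ denotes the Borel $\sigma$-algebra of $X$, and $\mathfrak{A}_X\otimes\mathfrak{A}_Y$ the product $\sigma$-algebra (equal to the Borel $\sigma$-algebra of $X\times Y$, by second countability). A quantum probability measure on a compact Hausdorff space $X$ with values in $\mathcal{B}(H)$ is a map $E:\mathfrak{A}_X\to\mathcal{B}(H)^+$ with $E(X)=I_H$ that is countably additive on disjoint sequences of Borel sets in the weak* topology; it is a spectral measure if every $E(\delta)$ is a projection. $E$ and $F$ have commuting ranges if $E(\delta)F(\theta)=F(\theta)E(\delta)$ for all $\delta,\theta$. *)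

theory Defs
  imports "HOL-Analysis.Analysis"
begin

section \<open>Complex Hilbert spaces\<close>

text \<open>The inner product is conjugate-linear in the first argument. Positive definiteness, the norm
  and the topology are inherited from \<^class>\<open>real_inner\<close>, whose inner product is required to be
  the real part of the complex one; hence \<open>norm x = sqrt (Re (cinner x x))\<close>.\<close>

class complex_inner = real_inner +
  fixes scaleC :: "complex \<Rightarrow> 'a \<Rightarrow> 'a" (infixr \<open>*\<^sub>C\<close> 75)
    and cinner :: "'a \<Rightarrow> 'a \<Rightarrow> complex"
  assumes scaleC_add_right: "a *\<^sub>C (x + y) = a *\<^sub>C x + a *\<^sub>C y"
    and scaleC_add_left: "(a + b) *\<^sub>C x = a *\<^sub>C x + b *\<^sub>C x"
    and scaleC_scaleC: "a *\<^sub>C b *\<^sub>C x = (a * b) *\<^sub>C x"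
    and scaleR_scaleC: "r *\<^sub>R x = complex_of_real r *\<^sub>C x"
    and cinner_commute: "cinner x y = cnj (cinner y x)"
    and cinner_add_right: "cinner x (y + z) = cinner x y + cinner x z"
    and cinner_scaleC_right: "cinner x (a *\<^sub>C y) = a * cinner x y"
    and inner_eq_Re_cinner: "inner x y = Re (cinner x y)"

class chilbert_space = complex_inner + complete_space

section \<open>Bounded operators and the weak* topology\<close>

definition bounded_clinear :: "('h::complex_inner \<Rightarrow> 'h) \<Rightarrow> bool" where
  "bounded_clinear T \<longleftrightarrow> bounded_linear T \<and> (\<forall>a x. T (a *\<^sub>C x) = a *\<^sub>C T x)"

definition positive_operator :: "('h::complex_inner \<Rightarrow> 'h) \<Rightarrow> bool" where
  "positive_operator T \<longleftrightarrow>
     bounded_clinear T \<and> (\<forall>x. cinner x (T x) \<in> \<real> \<and> 0 \<le> Re (cinner x (T x)))"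

definition is_projection :: "('h::complex_inner \<Rightarrow> 'h) \<Rightarrow> bool" where
  "is_projection P \<longleftrightarrow>
     bounded_clinear P \<and> P \<circ> P = P \<and> (\<forall>x y. cinner (P x) y = cinner x (P y))"

text \<open>An orthonormal basis is a maximal orthonormal set; it may be uncountable.\<close>

definition is_onb :: "'h::complex_inner set \<Rightarrow> bool" where
  "is_onb B \<longleftrightarrow> (\<forall>e\<in>B. norm e = 1) \<and> pairwise (\<lambda>e f. cinner e f = 0) B
     \<and> (\<forall>x. (\<forall>e\<in>B. cinner e x = 0) \<longrightarrow> x = 0)"

definition hilbert_schmidt :: "('h::complex_inner \<Rightarrow> 'h) \<Rightarrow> bool" where
  "hilbert_schmidt A \<longleftrightarrow>
     bounded_clinear A \<and> (\<exists>B. is_onb B \<and> (\<lambda>e. (norm (A e))\<^sup>2) summable_on B)"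

definition trace_class :: "('h::complex_inner \<Rightarrow> 'h) \<Rightarrow> bool" where
  "trace_class S \<longleftrightarrow> (\<exists>A B. hilbert_schmidt A \<and> hilbert_schmidt B \<and> S = A \<circ> B)"

text \<open>The trace of a trace class operator does not depend on the chosen orthonormal basis.\<close>

definition ctrace :: "('h::complex_inner \<Rightarrow> 'h) \<Rightarrow> complex" where
  "ctrace S = (\<Sum>\<^sub>\<infinity>e\<in>(SOME B. is_onb B). cinner e (S e))"

text \<open>The bounded operators are the dual of the trace class operators via
  \<open>T \<mapsto> (S \<mapsto> ctrace (T \<circ> S))\<close>. The weak* topology is the coarsest topology making each
  \<open>T \<mapsto> ctrace (T \<circ> S)\<close>, for \<open>S\<close> of trace class, continuous.\<close>

definition weak_star_topology :: "('h::complex_inner \<Rightarrow> 'h) topology" where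
  "weak_star_topology =
     pullback_topology {T. bounded_clinear T} (\<lambda>T. \<lambda>S\<in>{S. trace_class S}. ctrace (T \<circ> S))
       (product_topology (\<lambda>_. euclidean) {S. trace_class S})"

section \<open>Quantum probability measures\<close>

definition borel_of :: "'a topology \<Rightarrow> 'a measure" where
  "borel_of X = sigma (topspace X) {U. openin X U}"

text \<open>Only the measurable space underlying \<open>M\<close> matters. The values of \<open>E\<close> outside \<open>sets M\<close>
  are irrelevant.\<close>

definition quantum_prob_measure :: "'a measure \<Rightarrow> ('a set \<Rightarrow> 'h::chilbert_space \<Rightarrow> 'h) \<Rightarrow> bool" where
  "quantum_prob_measure M E \<longleftrightarrow>
     (\<forall>\<delta>\<in>sets M. positive_operator (E \<delta>)) \<and>
     E (space M) = id \<and>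
     (\<forall>A::nat \<Rightarrow> 'a set. range A \<subseteq> sets M \<longrightarrow> disjoint_family A \<longrightarrow>
        limitin weak_star_topology (\<lambda>n. \<lambda>h. \<Sum>k<n. E (A k) h) (E (\<Union>k. A k)) sequentially)"

definition spectral_measure :: "'a measure \<Rightarrow> ('a set \<Rightarrow> 'h::chilbert_space \<Rightarrow> 'h) \<Rightarrow> bool" where
  "spectral_measure M E \<longleftrightarrow>
     quantum_prob_measure M E \<and> (\<forall>\<delta>\<in>sets M. is_projection (E \<delta>))"

definition commuting_ranges ::
  "'a measure \<Rightarrow> 'b measure \<Rightarrow> ('a set \<Rightarrow> 'h \<Rightarrow> 'h) \<Rightarrow> ('b set \<Rightarrow> 'h \<Rightarrow> 'h) \<Rightarrow> bool" where
  "commuting_ranges M N E F \<longleftrightarrow> (\<forall>\<delta>\<in>sets M. \<forall>\<theta>\<in>sets N. E \<delta> \<circ> F \<theta> = F \<theta> \<circ> E \<delta>)"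

text \<open>Extensionality makes \<open>G\<close> a function on the product \<open>\<sigma>\<close>-algebra, so that uniqueness
  of \<open>G\<close> is uniqueness on measurable sets.\<close>

definition is_product_qpm ::
  "'a measure \<Rightarrow> 'b measure \<Rightarrow> ('a set \<Rightarrow> 'h::chilbert_space \<Rightarrow> 'h) \<Rightarrow> ('b set \<Rightarrow> 'h \<Rightarrow> 'h) \<Rightarrow>
     (('a \<times> 'b) set \<Rightarrow> 'h \<Rightarrow> 'h) \<Rightarrow> bool" where
  "is_product_qpm M N E F G \<longleftrightarrow>
     G \<in> extensional (sets (M \<Otimes>\<^sub>M N)) \<and>
     quantum_prob_measure (M \<Otimes>\<^sub>M N) G \<and>
     (\<forall>\<delta>\<in>sets M. \<forall>\<theta>\<in>sets N. G (\<delta> \<times> \<theta>) = E \<delta> \<circ> F \<theta>)"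

end

theory Submission
  imports Defs
begin

text \<open>For a vector \<open>h\<close>, the function \<open>(\<delta>, \<theta>) \<mapsto> \<langle>h, E \<delta> F \<theta> h\<rangle>\<close> is nonnegative, since a product of commuting
  positive operators is positive, and countably additive in each variable. Regularity of the marginals
  and compactness of \<open>X \<times> Y\<close> make it countably additive on rectangles, so by Caratheodory's theorem
  it extends to a measure \<open>\<mu> h\<close>. A Dynkin argument produces, for each measurable \<open>\<gamma>\<close>, an operator with
  quadratic form \<open>h \<mapsto> \<mu> h \<gamma>\<close>; the limits it needs exist because \<open>\<parallel>T h\<parallel>\<^sup>2 \<le> \<langle>h, T h\<rangle>\<close> whenever
  \<open>0 \<le> T \<le> I\<close>. The same inequality turns weak countable additivity into strong convergence, which
  implies weak* convergence by dominated convergence of Hilbert-Schmidt norms; conversely weak*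
  convergence is tested against rank one operators. Uniqueness and idempotence again follow by
  Dynkin arguments.\<close>

section \<open>Complex inner product spaces\<close>

text \<open>Additivity in each variable does not formally give additivity on rectangles: infinitely
  many rectangles may tile a rectangle without forming a grid, so the two one-variable limits cannot
  be combined. Only finite comparisons follow from positivity; compactness makes them sufficient.
  The cost of the approximation is measured by the two marginals, which are honest measures and
  hence regular. Obtaining the operator from \<open>h \<mapsto> \<mu> h \<gamma>\<close> by
  polarisation would require a parallelogram law for measures. The Dynkin argument carries the
  operator itself along instead, built from earlier ones by \<open>I - T\<close> and by strong sums.
  Real quadratic forms suffice for this because over complex scalars they determine a positive
  operator; additivity and the value on rectangles are checked on \<open>inner x (T x)\<close>
  alone.\<close>

instance chilbert_space \<subseteq> banach ..

lemma cinner_self: "cinner x x = complex_of_real ((norm x)\<^sup>2)"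
proof -
  have "Im (cinner x x) = 0"
    using arg_cong[OF cinner_commute[of x x], of Im] by simp
  moreover have "Re (cinner x x) = (norm x)\<^sup>2"
    by (simp flip: inner_eq_Re_cinner add: power2_norm_eq_inner)
  ultimately show ?thesis
    by (simp add: complex_eq_iff)
qed

lemma cinner_add_left: "cinner (x + y) z = cinner x z + cinner y z"
  by (metis cinner_add_right cinner_commute complex_cnj_add)

lemma cinner_scaleC_left: "cinner (a *\<^sub>C x) y = cnj a * cinner x y"
  by (metis cinner_commute cinner_scaleC_right complex_cnj_mult)

lemma norm_scaleC: "norm (a *\<^sub>C x) = cmod a * norm x"
proof -
  have "complex_of_real ((norm (a *\<^sub>C x))\<^sup>2) = of_real ((cmod a * norm x)\<^sup>2)"
    unfolding cinner_self[symmetric] cinner_scaleC_left cinner_scaleC_right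
    by (simp add: cinner_self power_mult_distrib complex_norm_square mult.commute mult.left_commute del: of_real_power)
  then show ?thesis
    by (simp only: of_real_eq_iff) (simp add: power2_eq_iff_nonneg)
qed

lemma cmod_cinner_le: "cmod (cinner x y) \<le> norm x * norm y"
proof (cases "cinner x y = 0")
  case False
  \<comment> \<open>A phase of modulus 1 that rotates \<open>cinner x y\<close> onto the positive
    real axis, so that the real Cauchy-Schwarz inequality applies.\<close>
  define a where "a = cnj (cinner x y) / of_real (cmod (cinner x y))"
  have "cmod (cinner x y) = Re (a * cinner x y)"
  proof -
    have "a * cinner x y = of_real ((cmod (cinner x y))\<^sup>2 / cmod (cinner x y))"
      by (simp only: a_def of_real_divide complex_norm_square times_divide_eq_left times_divide_eq_right mult.commute)
    then show ?thesis
      by (simp add: power2_eq_square)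
  qed
  also have "\<dots> = inner x (a *\<^sub>C y)"
    by (simp add: inner_eq_Re_cinner cinner_scaleC_right)
  also have "\<dots> \<le> norm x * norm (a *\<^sub>C y)"
    by (rule norm_cauchy_schwarz)
  also have "\<dots> = norm x * norm y"
    using False by (simp add: norm_scaleC a_def norm_divide)
  finally show ?thesis .
qed simp

interpretation cinner: bounded_bilinear "cinner :: 'h::complex_inner \<Rightarrow> 'h \<Rightarrow> complex"
proof
  show "\<exists>K. \<forall>a b. norm (cinner a b) \<le> norm a * norm (b::'h) * K"
    by (rule exI[of _ 1]) (simp add: cmod_cinner_le)
qed (simp_all add: cinner_add_left cinner_add_right scaleR_scaleC cinner_scaleC_left
    cinner_scaleC_right scaleR_conv_of_real)

interpretation scaleC: bounded_bilinear "scaleC :: complex \<Rightarrow> 'h::complex_inner \<Rightarrow> 'h"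
proof
  show "\<exists>K. \<forall>a b. norm (a *\<^sub>C (b::'h)) \<le> norm a * norm b * K"
    by (rule exI[of _ 1]) (simp add: norm_scaleC)
qed (simp_all add: scaleC_add_left scaleC_add_right scaleR_scaleC scaleC_scaleC scaleR_conv_of_real
    mult.commute)

lemma bounded_clinearD:
  assumes "bounded_clinear T"
  shows "bounded_linear T" "T (a *\<^sub>C x) = a *\<^sub>C T x"
  using assms by (auto simp: bounded_clinear_def)

lemma bounded_clinear_compose:
  assumes "bounded_clinear S" "bounded_clinear T"
  shows "bounded_clinear (S \<circ> T)"
  using assms bounded_linear_compose[of S T] by (auto simp: bounded_clinear_def o_def)

lemma bounded_clinear_diff:
  assumes "bounded_clinear S" "bounded_clinear T"
  shows "bounded_clinear (\<lambda>x. S x - T x)"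
  using assms by (auto simp: bounded_clinear_def bounded_linear_sub scaleC.diff_right)

lemma bounded_clinear_sum:
  assumes "\<And>i. i \<in> I \<Longrightarrow> bounded_clinear (T i)"
  shows "bounded_clinear (\<lambda>x. \<Sum>i\<in>I. T i x)"
  using assms by (auto simp: bounded_clinear_def scaleC.sum_right intro!: bounded_linear_sum)

lemma bounded_clinear_id: "bounded_clinear id"
  by (auto simp: bounded_clinear_def id_def)

section \<open>Orthonormal bases\<close>

definition orthonormal :: "'h::complex_inner set \<Rightarrow> bool" where
  "orthonormal B \<longleftrightarrow> (\<forall>e\<in>B. norm e = 1) \<and> pairwise (\<lambda>e f. cinner e f = 0) B"

lemma is_onb_imp_orthonormal: "is_onb B \<Longrightarrow> orthonormal B"
  by (simp add: is_onb_def orthonormal_def)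

lemma orthonormal_subset: "orthonormal B \<Longrightarrow> F \<subseteq> B \<Longrightarrow> orthonormal F"
  by (auto simp: orthonormal_def pairwise_def)

lemma orthonormal_cinner:
  assumes "orthonormal B" "e \<in> B" "f \<in> B"
  shows "cinner e f = (if e = f then 1 else 0)"
  using assms by (auto simp: orthonormal_def pairwise_def cinner_self)

lemma norm_sum_orthonormal:
  assumes "orthonormal F" "finite F"
  shows "(norm (\<Sum>e\<in>F. c e *\<^sub>C e))\<^sup>2 = (\<Sum>e\<in>F. (cmod (c e))\<^sup>2)"
proof -
  have "complex_of_real ((norm (\<Sum>e\<in>F. c e *\<^sub>C e))\<^sup>2)
      = (\<Sum>e\<in>F. \<Sum>f\<in>F. cnj (c e) * (c f * cinner e f))"
    unfolding cinner_self[symmetric]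
    unfolding cinner.sum_left cinner.sum_right
    by (subst sum.swap) (simp add: cinner_scaleC_left cinner_scaleC_right mult.left_commute)
  also have "\<dots> = (\<Sum>e\<in>F. \<Sum>f\<in>F. if f = e then cnj (c e) * c e else 0)"
    by (intro sum.cong refl) (auto simp: orthonormal_cinner[OF assms(1)])
  also have "\<dots> = (\<Sum>e\<in>F. cnj (c e) * c e)"
    using assms by simp
  also have "\<dots> = of_real (\<Sum>e\<in>F. (cmod (c e))\<^sup>2)"
    by (simp add: complex_norm_square mult.commute del: of_real_power)
  finally show ?thesis
    by (simp only: of_real_eq_iff)
qed

lemma summable_small_remainder:
  fixes g :: "'a \<Rightarrow> real"
  assumes "g summable_on B" "\<And>x. x \<in> B \<Longrightarrow> g x \<ge> 0" "\<epsilon> > 0"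
  obtains F where "finite F" "F \<subseteq> B" "infsum g (B - F) < \<epsilon>"
proof -
  obtain F where F: "finite F" "F \<subseteq> B" "dist (sum g F) (infsum g B) \<le> \<epsilon> / 2"
    using infsum_finite_approximation[OF assms(1), of "\<epsilon> / 2"] assms(3) by auto
  have "infsum g (F \<union> (B - F)) = infsum g F + infsum g (B - F)"
    using F assms by (intro infsum_Un_disjoint summable_on_subset_banach[OF assms(1)]) auto
  moreover have "F \<union> (B - F) = B"
    using F by auto
  ultimately have "infsum g (B - F) < \<epsilon>"
    using F assms(3) by (auto simp: dist_real_def)
  then show thesis
    using that F by blast
qed

text \<open>By Pythagoras a finite sum of terms outside \<open>F0\<close> has squared norm at most
  the tail of the coefficients, so the net of finite partial sums is Cauchy. This covers uncountable
  \<open>B\<close>.\<close>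

lemma orthonormal_summable:
  fixes c :: "'h::chilbert_space \<Rightarrow> complex"
  assumes B: "orthonormal B" and c: "(\<lambda>e. (cmod (c e))\<^sup>2) summable_on B"
  shows "(\<lambda>e. c e *\<^sub>C e) summable_on B"
proof -
  let ?f = "\<lambda>e. c e *\<^sub>C e"
  have "\<exists>P. eventually P (finite_subsets_at_top B) \<and>
              (\<forall>F F'. P F \<and> P F' \<longrightarrow> dist (sum ?f F) (sum ?f F') < \<epsilon>)" if "\<epsilon> > 0" for \<epsilon>
  proof -
    obtain F0 where F0: "finite F0" "F0 \<subseteq> B" "infsum (\<lambda>e. (cmod (c e))\<^sup>2) (B - F0) < (\<epsilon> / 2)\<^sup>2"
      using summable_small_remainder[OF c, of "(\<epsilon> / 2)\<^sup>2"] \<open>\<epsilon> > 0\<close> by auto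
    have small: "norm (sum ?f F) < \<epsilon> / 2" if F: "finite F" "F \<subseteq> B - F0" for F
    proof -
      have "(norm (sum ?f F))\<^sup>2 = (\<Sum>e\<in>F. (cmod (c e))\<^sup>2)"
        using F by (intro norm_sum_orthonormal orthonormal_subset[OF B]) auto
      also have "\<dots> \<le> infsum (\<lambda>e. (cmod (c e))\<^sup>2) (B - F0)"
        using F by (intro finite_sum_le_infsum summable_on_subset_banach[OF c]) auto
      finally show ?thesis
        using F0 \<open>\<epsilon> > 0\<close> by (intro power2_less_imp_less[of _ "\<epsilon> / 2"]) auto
    qed
    have "dist (sum ?f F) (sum ?f F') < \<epsilon>"
      if "finite F \<and> F0 \<subseteq> F \<and> F \<subseteq> B" "finite F' \<and> F0 \<subseteq> F' \<and> F' \<subseteq> B" for F F'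
    proof -
      have "sum ?f G = sum ?f (G - F0) + sum ?f F0" if "finite G \<and> F0 \<subseteq> G \<and> G \<subseteq> B" for G
        using that by (intro sum.subset_diff) auto
      from this[of F] this[of F'] that have "dist (sum ?f F) (sum ?f F') = norm (sum ?f (F - F0) - sum ?f (F' - F0))"
        by (simp add: dist_norm)
      also have "\<dots> \<le> norm (sum ?f (F - F0)) + norm (sum ?f (F' - F0))"
        by (rule norm_triangle_ineq4)
      also have "\<dots> < \<epsilon> / 2 + \<epsilon> / 2"
        using that by (intro add_strict_mono small) auto
      finally show ?thesis by simp
    qed
    moreover have "eventually (\<lambda>F. finite F \<and> F0 \<subseteq> F \<and> F \<subseteq> B) (finite_subsets_at_top B)"
      using F0 by (auto simp: eventually_finite_subsets_at_top)
    ultimately show ?thesis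
      by (intro exI[of _ "\<lambda>F. finite F \<and> F0 \<subseteq> F \<and> F \<subseteq> B"]) blast
  qed
  then have "cauchy_filter (filtermap (sum ?f) (finite_subsets_at_top B))"
    by (simp add: cauchy_filter_metric_filtermap)
  moreover have "complete (UNIV :: 'h set)"
    by (meson Cauchy_convergent UNIV_I complete_def convergent_def)
  ultimately obtain L where "(sum ?f \<longlongrightarrow> L) (finite_subsets_at_top B)"
    using complete_uniform[where S=UNIV] by (force simp add: filterlim_def)
  then show ?thesis
    using summable_on_def has_sum_def by blast
qed

definition bounded_cfunctional :: "('h::complex_inner \<Rightarrow> complex) \<Rightarrow> bool" where
  "bounded_cfunctional \<phi> \<longleftrightarrow> bounded_linear \<phi> \<and> (\<forall>a x. \<phi> (a *\<^sub>C x) = a * \<phi> x)"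

lemma bounded_cfunctional_cinner: "bounded_cfunctional (cinner x)"
  by (simp add: bounded_cfunctional_def cinner.bounded_linear_right cinner_scaleC_right)

text \<open>The functional is evaluated at \<open>z\<close>, whose coefficients are its own
  conjugated values: \<open>\<phi> z = s\<close> while \<open>norm z = sqrt s\<close>. A functional
  rather than a vector is treated because the Riesz theorem is derived from this bound.\<close>

lemma bessel:
  assumes \<phi>: "bounded_cfunctional \<phi>" and F: "orthonormal F" "finite F"
  shows "(\<Sum>e\<in>F. (cmod (\<phi> e))\<^sup>2) \<le> (onorm \<phi>)\<^sup>2"
proof -
  have lin: "bounded_linear \<phi>"
    using \<phi> by (simp add: bounded_cfunctional_def)
  define s where "s = (\<Sum>e\<in>F. (cmod (\<phi> e))\<^sup>2)"
  define z where "z = (\<Sum>e\<in>F. cnj (\<phi> e) *\<^sub>C e)"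
  have s0: "s \<ge> 0"
    by (simp add: s_def sum_nonneg)
  have "\<phi> z = of_real s"
    using \<phi> unfolding z_def s_def linear_sum[OF bounded_linear.linear[OF lin]]
    by (simp add: bounded_cfunctional_def complex_norm_square mult.commute del: of_real_power)
  then have "s \<le> onorm \<phi> * norm z"
    using onorm[OF lin, of z] s0 by simp
  moreover have "norm z = sqrt s"
    using norm_sum_orthonormal[OF F, of "\<lambda>e. cnj (\<phi> e)"]
    by (simp add: z_def s_def real_sqrt_unique)
  ultimately have "sqrt s * sqrt s \<le> onorm \<phi> * sqrt s"
    using s0 by simp
  then have "sqrt s \<le> onorm \<phi> \<or> sqrt s = 0"
    using s0 by (metis antisym_conv2 mult_le_cancel_right real_sqrt_ge_zero)
  then have "sqrt s \<le> onorm \<phi>"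
    using onorm_pos_le[OF lin] by auto
  then show ?thesis
    unfolding s_def[symmetric] using s0 by (simp add: sqrt_le_D)
qed

lemma bessel_summable:
  assumes "bounded_cfunctional \<phi>" and "orthonormal B"
  shows "(\<lambda>e. (cmod (\<phi> e))\<^sup>2) summable_on B"
proof (rule nonneg_bounded_partial_sums_imp_summable_on)
  show "\<forall>\<^sub>F F in finite_subsets_at_top B. (\<Sum>e\<in>F. (cmod (\<phi> e))\<^sup>2) \<le> (onorm \<phi>)\<^sup>2"
    by (intro eventually_finite_subsets_at_top_weakI bessel[OF assms(1)] orthonormal_subset[OF assms(2)])
qed auto

lemma has_sum_scaleC_cinner:
  assumes "orthonormal B" "f \<in> B" "((\<lambda>e. c e *\<^sub>C e) has_sum v) B"
  shows "cinner f v = c f"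
proof -
  have "((\<lambda>e. cinner f (c e *\<^sub>C e)) has_sum cinner f v) B"
    using has_sum_bounded_linear[OF cinner.bounded_linear_right assms(3), of f] by (simp add: o_def)
  moreover have "((\<lambda>e. cinner f (c e *\<^sub>C e)) has_sum c f) B"
  proof (rule has_sum_finite_neutralI[of "{f}"])
    show "\<And>e. e \<in> B - {f} \<Longrightarrow> cinner f (c e *\<^sub>C e) = 0"
      using assms by (auto simp: cinner_scaleC_right orthonormal_cinner[OF assms(1)])
  qed (use assms in \<open>auto simp: cinner_scaleC_right orthonormal_cinner[OF assms(1)]\<close>)
  ultimately show ?thesis
    using has_sum_unique by blast
qed

text \<open>Bessel makes the series converge to some \<open>v\<close>; \<open>x - v\<close> is
  orthogonal to \<open>B\<close>, so maximality of \<open>B\<close> gives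
  \<open>x = v\<close>.\<close>

lemma onb_expansion:
  fixes x :: "'h::chilbert_space"
  assumes "is_onb B"
  shows "((\<lambda>e. cinner e x *\<^sub>C e) has_sum x) B"
proof -
  have B: "orthonormal B"
    using assms by (rule is_onb_imp_orthonormal)
  have "(\<lambda>e. (cmod (cinner e x))\<^sup>2) summable_on B"
    using bessel_summable[OF bounded_cfunctional_cinner[of x] B]
    by (subst cinner_commute) simp
  from orthonormal_summable[OF B this] obtain v where v: "((\<lambda>e. cinner e x *\<^sub>C e) has_sum v) B"
    by (auto simp: summable_on_def)
  then have "\<forall>e\<in>B. cinner e (x - v) = 0"
    using has_sum_scaleC_cinner[OF B _ v] by (simp add: cinner.diff_right)
  then have "x - v = 0"
    using assms by (auto simp: is_onb_def)
  with v show ?thesis by simp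
qed

lemma parseval:
  fixes x :: "'h::chilbert_space"
  assumes "is_onb B"
  shows "((\<lambda>e. cinner e x * cinner y e) has_sum cinner y x) B"
  using has_sum_bounded_linear[OF cinner.bounded_linear_right[of y] onb_expansion[OF assms, of x]]
  by (simp add: o_def cinner_scaleC_right)

lemma parseval_norm:
  fixes x :: "'h::chilbert_space"
  assumes "is_onb B"
  shows "((\<lambda>e. (cmod (cinner e x))\<^sup>2) has_sum (norm x)\<^sup>2) B"
proof -
  have *: "Re (cinner e x * cinner x e) = (cmod (cinner e x))\<^sup>2" for e
    by (subst cinner_commute[of x e]) (simp add: complex_norm_square[symmetric] del: of_real_power)
  show ?thesis
    using has_sum_bounded_linear[OF bounded_linear_Re parseval[OF assms, of x x]]
    unfolding o_def * by (simp add: cinner_self)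
qed

lemma onb_exists: "\<exists>B. is_onb (B :: 'h::complex_inner set)"
proof -
  let ?A = "Collect orthonormal :: 'h set set"
  have "\<exists>M\<in>?A. \<forall>X\<in>?A. M \<subseteq> X \<longrightarrow> X = M"
  proof (rule subset_Zorn')
    fix \<C> assume "subset.chain ?A \<C>"
    then have on: "\<And>X. X \<in> \<C> \<Longrightarrow> orthonormal X"
      and chain: "\<And>X Y. X \<in> \<C> \<Longrightarrow> Y \<in> \<C> \<Longrightarrow> X \<subseteq> Y \<or> Y \<subseteq> X"
      by (auto simp: subset_chain_def)
    have "cinner e f = 0" if ef: "e \<in> \<Union>\<C>" "f \<in> \<Union>\<C>" "e \<noteq> f" for e f
    proof -
      obtain X where "X \<in> \<C>" "e \<in> X" "f \<in> X"
        using ef chain by blast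
      then show ?thesis
        using orthonormal_cinner[OF on] ef(3) by auto
    qed
    moreover have "norm e = 1" if "e \<in> \<Union>\<C>" for e
      using that on by (auto simp: orthonormal_def)
    ultimately show "\<Union>\<C> \<in> ?A"
      by (auto simp: orthonormal_def pairwise_def)
  qed
  then obtain M :: "'h set" where M: "orthonormal M" and max: "\<And>X. orthonormal X \<Longrightarrow> M \<subseteq> X \<Longrightarrow> X = M"
    by auto
  have "x = 0" if x: "\<forall>e\<in>M. cinner e x = 0" for x :: 'h
  proof (rule ccontr)
    assume "x \<noteq> 0"
    define u where "u = x /\<^sub>R norm x"
    have u: "norm u = 1" "\<forall>e\<in>M. cinner e u = 0"
      using \<open>x \<noteq> 0\<close> x by (auto simp: u_def cinner.scaleR_right)
    then have u': "\<forall>e\<in>M. cinner u e = 0"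
      by (metis cinner_commute complex_cnj_zero)
    have "orthonormal (insert u M)"
      using M u u' by (auto simp: orthonormal_def pairwise_insert)
    then have "u \<in> M"
      using max[of "insert u M"] by auto
    then show False
      using u by (auto simp: cinner_self)
  qed
  with M show ?thesis
    by (auto simp: is_onb_def orthonormal_def)
qed

text \<open>The representing vector is written in coordinates, with coefficient
  \<open>cnj (\<phi> e)\<close> at \<open>e\<close>; Bessel's inequality for \<phi> makes the series
  converge.\<close>

lemma riesz_representation:
  fixes \<phi> :: "'h::chilbert_space \<Rightarrow> complex"
  assumes \<phi>: "bounded_cfunctional \<phi>"
  shows "\<exists>v. \<forall>x. \<phi> x = cinner v x"
proof -
  obtain B :: "'h set" where B: "is_onb B"
    using onb_exists by blast
  have "(\<lambda>e. (cmod (cnj (\<phi> e)))\<^sup>2) summable_on B"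
    using bessel_summable[OF \<phi> is_onb_imp_orthonormal[OF B]] by simp
  then obtain v where v: "((\<lambda>e. cnj (\<phi> e) *\<^sub>C e) has_sum v) B"
    using orthonormal_summable[OF is_onb_imp_orthonormal[OF B], of "\<lambda>e. cnj (\<phi> e)"]
    by (auto simp: summable_on_def)
  have "\<phi> x = cinner v x" for x
  proof -
    have "((\<lambda>e. cinner e x * \<phi> e) has_sum \<phi> x) B"
      using has_sum_bounded_linear[OF _ onb_expansion[OF B, of x], of \<phi>] \<phi>
      by (simp add: o_def bounded_cfunctional_def)
    moreover have "((\<lambda>e. cinner e x * \<phi> e) has_sum cinner v x) B"
    proof -
      have "cinner v e = \<phi> e" if "e \<in> B" for e
        using has_sum_scaleC_cinner[OF is_onb_imp_orthonormal[OF B] that v]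
        by (metis cinner_commute complex_cnj_cnj)
      then show ?thesis
        using parseval[OF B, of x v] by (simp cong: has_sum_cong)
    qed
    ultimately show ?thesis
      using has_sum_unique by blast
  qed
  then show ?thesis by blast
qed

lemma adjoint_exists:
  fixes T :: "'h::chilbert_space \<Rightarrow> 'h"
  assumes "bounded_clinear T"
  shows "\<exists>S. \<forall>x y. cinner (S x) y = cinner x (T y)"
proof -
  have "\<exists>v. \<forall>y. cinner x (T y) = cinner v y" for x
  proof (rule riesz_representation)
    show "bounded_cfunctional (\<lambda>y. cinner x (T y))"
      using assms bounded_linear_compose[OF cinner.bounded_linear_right bounded_clinearD(1)[OF assms]]
      by (simp add: bounded_cfunctional_def bounded_clinear_def cinner_scaleC_right)
  qed
  then show ?thesis by metis
qed

section \<open>Hilbert-Schmidt operators and the trace\<close>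

text \<open>Both sums are iterated sums of \<open>(cmod (cinner f (A e)))\<^sup>2\<close> over
  \<open>B \<times> C\<close>, taken in opposite orders. Since the adjoint also changes the basis,
  two applications give independence of the basis.\<close>

lemma hilbert_schmidt_adjoint:
  fixes A S :: "'h::chilbert_space \<Rightarrow> 'h"
  assumes adj: "\<And>x y. cinner (S x) y = cinner x (A y)" and B: "is_onb B" and C: "is_onb C"
    and s: "((\<lambda>e. (norm (A e))\<^sup>2) has_sum s) B"
  shows "((\<lambda>f. (norm (S f))\<^sup>2) has_sum s) C"
proof -
  let ?g = "\<lambda>(e, f). (cmod (cinner f (A e)))\<^sup>2"
  have rows: "((\<lambda>f. ?g (e, f)) has_sum (norm (A e))\<^sup>2) C" for e
    using parseval_norm[OF C] by simp
  have "?g summable_on B \<times> C"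
    by (rule summable_on_SigmaI[OF rows]) (use s in \<open>auto simp: summable_on_def\<close>)
  then have "(?g has_sum s) (B \<times> C)"
    by (intro has_sum_SigmaI[OF rows s])
  then have "((\<lambda>(f, e). ?g (e, f)) has_sum s) (C \<times> B)"
    by (subst (asm) has_sum_swap)
  moreover have "((\<lambda>e. case (f, e) of (f, e) \<Rightarrow> ?g (e, f)) has_sum (norm (S f))\<^sup>2) B" for f
  proof -
    have *: "cmod (cinner f (A e)) = cmod (cinner e (S f))" for e
      by (metis adj cinner_commute complex_mod_cnj)
    show ?thesis
      using parseval_norm[OF B, of "S f"] by (simp add: *)
  qed
  ultimately show ?thesis
    by (rule has_sum_SigmaD)
qed

text \<open>Moving \<open>P\<close> to the left as its adjoint, this is the Cauchy-Schwarz inequality for the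
  Hilbert-Schmidt inner product.\<close>

lemma trace_bound:
  fixes P Q :: "'h::chilbert_space \<Rightarrow> 'h"
  assumes P: "bounded_clinear P" and Q: "bounded_clinear Q"
    and U: "is_onb U" "((\<lambda>e. (norm (P e))\<^sup>2) has_sum p) U"
    and V: "is_onb V" "((\<lambda>e. (norm (Q e))\<^sup>2) has_sum q) V"
    and C: "is_onb C"
  shows "(\<lambda>e. cmod (cinner e (P (Q e)))) summable_on C"
    and "cmod (\<Sum>\<^sub>\<infinity>e\<in>C. cinner e (P (Q e))) \<le> sqrt p * sqrt q"
proof -
  obtain P' where P': "\<And>x y. cinner (P' x) y = cinner x (P y)"
    using adjoint_exists[OF P] by blast
  obtain Q' where Q': "\<And>x y. cinner (Q' x) y = cinner x (Q y)"
    using adjoint_exists[OF Q] by blast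
  have Q'': "cinner (Q x) y = cinner x (Q' y)" for x y
    by (metis Q' cinner_commute)
  have p: "((\<lambda>e. (norm (P' e))\<^sup>2) has_sum p) C"
    by (rule hilbert_schmidt_adjoint[OF P' U(1) C U(2)])
  \<comment> \<open>Two passages to the adjoint, from \<open>Q\<close> over \<open>V\<close> to
    \<open>Q'\<close> over \<open>C\<close> and back to \<open>Q\<close> over \<open>C\<close>,
    exchange the basis.\<close>
  have q: "((\<lambda>e. (norm (Q e))\<^sup>2) has_sum q) C"
    by (rule hilbert_schmidt_adjoint[OF Q'' C C hilbert_schmidt_adjoint[OF Q' V(1) C V(2)]])
  have le: "(\<Sum>e\<in>F. cmod (cinner e (P (Q e)))) \<le> sqrt p * sqrt q" if F: "finite F" "F \<subseteq> C" for F
  proof -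
    have "(\<Sum>e\<in>F. cmod (cinner e (P (Q e)))) \<le> (\<Sum>e\<in>F. \<bar>norm (P' e)\<bar> * \<bar>norm (Q e)\<bar>)"
      by (intro sum_mono) (simp add: cmod_cinner_le flip: P')
    also have "\<dots> \<le> L2_set (\<lambda>e. norm (P' e)) F * L2_set (\<lambda>e. norm (Q e)) F"
      by (rule L2_set_mult_ineq)
    also have "\<dots> \<le> sqrt p * sqrt q"
      unfolding L2_set_def using F
      by (intro mult_mono real_sqrt_le_mono finite_sum_le_has_sum[OF p] finite_sum_le_has_sum[OF q])
        (auto intro!: sum_nonneg has_sum_nonneg[OF p])
    finally show ?thesis .
  qed
  show sm: "(\<lambda>e. cmod (cinner e (P (Q e)))) summable_on C"
    by (rule nonneg_bounded_partial_sums_imp_summable_on)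
      (auto intro!: eventually_finite_subsets_at_top_weakI le)
  have "cmod (\<Sum>\<^sub>\<infinity>e\<in>C. cinner e (P (Q e))) \<le> (\<Sum>\<^sub>\<infinity>e\<in>C. cmod (cinner e (P (Q e))))"
    by (rule norm_infsum_bound[OF sm])
  also have "\<dots> \<le> sqrt p * sqrt q"
    by (rule infsum_le_finite_sums[OF sm le])
  finally show "cmod (\<Sum>\<^sub>\<infinity>e\<in>C. cinner e (P (Q e))) \<le> sqrt p * sqrt q" .
qed

text \<open>Dominated convergence over an index set of any size: a finite \<open>F\<close> carries
  all but \<open>r / 2\<close> of the sum of \<open>g\<close>, and on \<open>F\<close> the limit is
  a finite sum.\<close>

lemma infsum_dominated_tendsto_0:
  fixes f :: "nat \<Rightarrow> 'a \<Rightarrow> real"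
  assumes g: "g summable_on B" and f: "\<And>n x. x \<in> B \<Longrightarrow> 0 \<le> f n x \<and> f n x \<le> g x"
    and lim: "\<And>x. x \<in> B \<Longrightarrow> (\<lambda>n. f n x) \<longlonglongrightarrow> 0"
  shows "(\<lambda>n. infsum (f n) B) \<longlonglongrightarrow> 0"
proof (rule LIMSEQ_I)
  fix r :: real assume "r > 0"
  have g0: "g x \<ge> 0" if "x \<in> B" for x
    using f[OF that] by fastforce
  have f_sum: "f n summable_on S" if "S \<subseteq> B" for n S
    using that f
    by (intro summable_on_comparison_test[OF summable_on_subset_banach[OF g that]]) auto
  obtain F where F: "finite F" "F \<subseteq> B" "infsum g (B - F) < r / 2"
    using summable_small_remainder[OF g g0, of "r / 2"] \<open>r > 0\<close> by auto
  have "(\<lambda>n. sum (f n) F) \<longlonglongrightarrow> (\<Sum>x\<in>F. 0)"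
    using F by (intro tendsto_sum lim) auto
  then have "\<forall>\<^sub>F n in sequentially. sum (f n) F < r / 2"
    using \<open>r > 0\<close> by (intro order_tendstoD(2)[of _ 0]) auto
  then obtain N where N: "\<And>n. n \<ge> N \<Longrightarrow> sum (f n) F < r / 2"
    by (auto simp: eventually_sequentially)
  have "norm (infsum (f n) B - 0) < r" if "n \<ge> N" for n
  proof -
    have "infsum (f n) (F \<union> (B - F)) = infsum (f n) F + infsum (f n) (B - F)"
      using F by (intro infsum_Un_disjoint f_sum) auto
    moreover have "F \<union> (B - F) = B"
      using F by auto
    moreover have "infsum (f n) (B - F) \<le> infsum g (B - F)"
      using f by (intro infsum_mono f_sum summable_on_subset_banach[OF g]) auto
    moreover have "infsum (f n) B \<ge> 0"
      using f by (intro infsum_nonneg) auto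
    ultimately show ?thesis
      using N[OF that] F by auto
  qed
  then show "\<exists>N. \<forall>n\<ge>N. norm (infsum (f n) B - 0) < r"
    by blast
qed

lemma hilbert_schmidt_compose:
  assumes T: "bounded_clinear T" and A: "(\<lambda>e. (norm (A e))\<^sup>2) summable_on B"
  shows "(\<lambda>e. (norm ((T \<circ> A) e))\<^sup>2) summable_on B"
proof -
  have "(norm (T (A e)))\<^sup>2 \<le> (onorm T)\<^sup>2 * (norm (A e))\<^sup>2" for e
    unfolding power_mult_distrib[symmetric]
    by (intro power_mono onorm bounded_clinearD[OF T]) simp
  then show ?thesis
    by (intro summable_on_comparison_test[OF summable_on_cmult_right[OF A, of "(onorm T)\<^sup>2"]]) auto
qed

section \<open>Convergence in the weak* topology\<close>

lemma limitin_pullback_topology: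
  "limitin (pullback_topology A g T) f l F \<longleftrightarrow>
     l \<in> A \<and> (\<forall>\<^sub>F n in F. f n \<in> A) \<and> limitin T (\<lambda>n. g (f n)) (g l) F"
proof
  assume L: "limitin (pullback_topology A g T) f l F"
  then have l: "l \<in> A" "g l \<in> topspace T"
    by (auto simp: limitin_def topspace_pullback_topology)
  have *: "\<forall>\<^sub>F n in F. f n \<in> g -` U \<inter> A" if "openin T U" "g l \<in> U" for U
    using L that l by (intro limitinD[OF L]) (auto simp: openin_pullback_topology)
  have "\<forall>\<^sub>F n in F. f n \<in> A"
    using *[OF openin_topspace l(2)] by eventually_elim auto
  moreover have "limitin T (\<lambda>n. g (f n)) (g l) F"
    unfolding limitin_def using l by (auto elim!: eventually_mono[OF *])
  ultimately show "l \<in> A \<and> (\<forall>\<^sub>F n in F. f n \<in> A) \<and> limitin T (\<lambda>n. g (f n)) (g l) F"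
    using l by blast
next
  assume R: "l \<in> A \<and> (\<forall>\<^sub>F n in F. f n \<in> A) \<and> limitin T (\<lambda>n. g (f n)) (g l) F"
  show "limitin (pullback_topology A g T) f l F"
    unfolding limitin_def openin_pullback_topology topspace_pullback_topology
  proof (intro conjI allI impI)
    show "l \<in> g -` topspace T \<inter> A"
      using R by (auto simp: limitin_def)
  next
    fix U assume "(\<exists>V. openin T V \<and> U = g -` V \<inter> A) \<and> l \<in> U"
    then obtain V where V: "openin T V" "U = g -` V \<inter> A" "g l \<in> V"
      by auto
    then have "\<forall>\<^sub>F n in F. g (f n) \<in> V"
      using R limitinD by metis
    with R show "\<forall>\<^sub>F n in F. f n \<in> U"
      unfolding V by (auto elim: eventually_elim2)
  qed
qed

lemma limitin_weak_star:
  "limitin weak_star_topology f l F \<longleftrightarrow>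
     bounded_clinear l \<and> (\<forall>\<^sub>F n in F. bounded_clinear (f n)) \<and>
     (\<forall>S. trace_class S \<longrightarrow> ((\<lambda>n. ctrace (f n \<circ> S)) \<longlongrightarrow> ctrace (l \<circ> S)) F)"
  unfolding weak_star_topology_def limitin_pullback_topology limitin_componentwise
  by (auto simp: PiE_def)

text \<open>Names the basis hidden in the choice inside \<open>ctrace\<close>, so that Parseval can
  be applied to that very basis.\<close>

lemma ctrace_eq:
  "\<exists>B. is_onb B \<and> (\<forall>S::'h::complex_inner \<Rightarrow> 'h. ctrace S = (\<Sum>\<^sub>\<infinity>e\<in>B. cinner e (S e)))"
  using someI_ex[OF onb_exists] by (auto simp: ctrace_def)

lemma weak_star_limit_imp_weak_limit:
  fixes f :: "'i \<Rightarrow> 'h::chilbert_space \<Rightarrow> 'h"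
  assumes "limitin weak_star_topology f l F"
  shows "((\<lambda>n. cinner h (f n h)) \<longlongrightarrow> cinner h (l h)) F"
proof (cases "h = 0")
  case False
  obtain B :: "'h set" where B: "is_onb B"
    and tr: "\<And>S::'h \<Rightarrow> 'h. ctrace S = (\<Sum>\<^sub>\<infinity>e\<in>B. cinner e (S e))"
    using ctrace_eq by blast
  \<comment> \<open>\<open>R 1\<close> is the rank one operator \<open>|h><h|\<close>, whose trace
    pairing with \<open>T\<close> is \<open>\<langle>h, T h\<rangle>\<close>; the scalar
    \<open>a\<close> serves the factorisation below.\<close>
  define R where "R a = (\<lambda>x. (a * cinner h x) *\<^sub>C h)" for a
  have R_lin: "bounded_clinear (R a)" for a
    unfolding R_def bounded_clinear_def
    by (auto intro!: bounded_linear_compose[OF scaleC.bounded_linear_left]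
        bounded_linear_compose[OF bounded_linear_mult_right] cinner.bounded_linear_right
        simp: cinner_scaleC_right scaleC_scaleC mult_ac)
  have "(\<lambda>e. (norm (R a e))\<^sup>2) summable_on B" for a
  proof -
    have *: "(norm (R a e))\<^sup>2 = (cmod (cinner h e))\<^sup>2 * ((cmod a * norm h)\<^sup>2)" for e
      by (simp add: R_def norm_scaleC norm_mult power_mult_distrib)
    show ?thesis
      unfolding * by (intro summable_on_cmult_left bessel_summable
          bounded_cfunctional_cinner is_onb_imp_orthonormal B)
  qed
  then have hs: "hilbert_schmidt (R a)" for a
    using R_lin B by (auto simp: hilbert_schmidt_def)
  \<comment> \<open>Trace class asks for a product of two Hilbert-Schmidt operators;
    \<open>1 / cinner h h\<close> cancels the factor that composition creates.\<close>
  have "R 1 = R 1 \<circ> R (1 / cinner h h)"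
    using False by (auto simp: R_def fun_eq_iff cinner_scaleC_right cinner_self)
  then have "trace_class (R 1)"
    using hs unfolding trace_class_def by blast
  then have "((\<lambda>n. ctrace (f n \<circ> R 1)) \<longlongrightarrow> ctrace (l \<circ> R 1)) F"
    using assms by (simp add: limitin_weak_star)
  moreover have "ctrace (T \<circ> R 1) = cinner h (T h)" if "bounded_clinear T" for T
  proof -
    have "((\<lambda>e. cinner e (T (R 1 e))) has_sum cinner h (T h)) B"
      using parseval[OF B, of "T h" h]
      by (simp add: R_def bounded_clinearD[OF that] cinner_scaleC_right mult.commute)
    then show ?thesis
      by (simp add: tr infsumI)
  qed
  moreover have "\<forall>\<^sub>F n in F. bounded_clinear (f n)" "bounded_clinear l"
    using assms by (auto simp: limitin_weak_star)
  ultimately show ?thesis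
    by (auto elim!: Lim_transform_eventually elim: eventually_mono)
qed (simp add: cinner.zero_left)

text \<open>With \<open>R n = f n - l\<close>, the trace of \<open>R n \<circ> P \<circ> Q\<close>
  is at most the Hilbert-Schmidt norm of \<open>R n \<circ> P\<close> times that of
  \<open>Q\<close>. The first factor tends to 0 by dominated convergence, with majorant
  \<open>(norm (P e))\<^sup>2\<close> supplied by \<open>bound\<close>.\<close>

lemma strong_limit_imp_weak_star_limit:
  fixes f :: "nat \<Rightarrow> 'h::chilbert_space \<Rightarrow> 'h"
  assumes l: "bounded_clinear l" and f: "\<And>n. bounded_clinear (f n)"
    and bound: "\<And>n x. norm (f n x - l x) \<le> norm x"
    and lim: "\<And>x. (\<lambda>n. f n x) \<longlonglongrightarrow> l x"
  shows "limitin weak_star_topology f l sequentially"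
  unfolding limitin_weak_star
proof (intro conjI allI impI always_eventually l f)
  fix S :: "'h \<Rightarrow> 'h" assume "trace_class S"
  then obtain P Q U V where S: "S = P \<circ> Q" and PQ: "bounded_clinear P" "bounded_clinear Q"
    and UV: "is_onb U" "is_onb V"
    and P: "(\<lambda>e. (norm (P e))\<^sup>2) summable_on U" and Q: "(\<lambda>e. (norm (Q e))\<^sup>2) summable_on V"
    by (auto simp: trace_class_def hilbert_schmidt_def)
  obtain B :: "'h set" where B: "is_onb B"
    and tr: "\<And>S::'h \<Rightarrow> 'h. ctrace S = (\<Sum>\<^sub>\<infinity>e\<in>B. cinner e (S e))"
    using ctrace_eq by blast
  define R where "R n = (\<lambda>x. f n x - l x)" for n
  have R: "bounded_clinear (R n)" for n
    unfolding R_def by (intro bounded_clinear_diff f l)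
  note tb = trace_bound[OF bounded_clinear_compose[OF _ PQ(1)] PQ(2) UV(1)
      has_sum_infsum[OF hilbert_schmidt_compose[OF _ P]] UV(2) has_sum_infsum[OF Q] B]
  have sm: "(\<lambda>e. cinner e (T (S e))) summable_on B" if "bounded_clinear T" for T
    using abs_summable_summable[OF tb(1)[OF that that]] by (simp add: S)
  have eq: "ctrace (f n \<circ> S) - ctrace (l \<circ> S) = ctrace (R n \<circ> S)" for n
    using infsum_add[OF sm[OF R] sm[OF l], of n] by (simp add: tr R_def cinner.diff_right)
  have le: "cmod (ctrace (R n \<circ> S))
      \<le> sqrt (\<Sum>\<^sub>\<infinity>e\<in>U. (norm (R n (P e)))\<^sup>2) * sqrt (\<Sum>\<^sub>\<infinity>e\<in>V. (norm (Q e))\<^sup>2)" for n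
    using tb(2)[OF R R] by (simp add: tr S)
  have null: "(\<lambda>n. sqrt (\<Sum>\<^sub>\<infinity>e\<in>U. (norm (R n (P e)))\<^sup>2) * sqrt (\<Sum>\<^sub>\<infinity>e\<in>V. (norm (Q e))\<^sup>2)) \<longlonglongrightarrow> 0"
  proof -
    have "(\<lambda>n. \<Sum>\<^sub>\<infinity>e\<in>U. (norm (R n (P e)))\<^sup>2) \<longlonglongrightarrow> 0"
    proof (rule infsum_dominated_tendsto_0[OF P])
      fix e
      show "\<And>n. 0 \<le> (norm (R n (P e)))\<^sup>2 \<and> (norm (R n (P e)))\<^sup>2 \<le> (norm (P e))\<^sup>2"
        by (simp add: R_def bound power_mono)
      have "(\<lambda>n. (norm (R n (P e)))\<^sup>2) \<longlonglongrightarrow> (norm (l (P e) - l (P e)))\<^sup>2"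
        unfolding R_def by (intro tendsto_intros lim)
      then show "(\<lambda>n. (norm (R n (P e)))\<^sup>2) \<longlonglongrightarrow> 0" by simp
    qed
    from tendsto_mult_left_zero[OF tendsto_real_sqrt[OF this, simplified]] show ?thesis .
  qed
  have "(\<lambda>n. ctrace (f n \<circ> S) - ctrace (l \<circ> S)) \<longlonglongrightarrow> 0"
    by (rule Lim_null_comparison[OF _ null]) (use le in \<open>simp add: eq\<close>)
  then show "(\<lambda>n. ctrace (f n \<circ> S)) \<longlonglongrightarrow> ctrace (l \<circ> S)"
    by (rule Lim_null[THEN iffD2])
qed

section \<open>Positive operators and effects\<close>

text \<open>Polarisation: the diagonal at \<open>x + y\<close> gives
  \<open>D x y + D y x = 0\<close>, and at \<open>x + \<i> *\<^sub>C y\<close> it gives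
  \<open>D x y - D y x = 0\<close>. Complex scalars matter: a right-angle rotation of the real plane
  has zero quadratic form.\<close>

lemma sesquilinear_eq_0:
  fixes D :: "'h::complex_inner \<Rightarrow> 'h \<Rightarrow> complex"
  assumes add: "\<And>x y z. D (x + y) z = D x z + D y z" "\<And>x y z. D x (y + z) = D x y + D x z"
    and scale: "\<And>a x y. D (a *\<^sub>C x) y = cnj a * D x y" "\<And>a x y. D x (a *\<^sub>C y) = a * D x y"
    and diag: "\<And>x. D x x = 0"
  shows "D x y = 0"
proof -
  have "D x y + D y x = 0"
    using diag[of "x + y"] diag[of x] diag[of y] by (simp add: add add.commute)
  moreover have "\<i> * D x y - \<i> * D y x = 0"
    using diag[of "x + \<i> *\<^sub>C y"] diag[of x] diag[of y] by (simp add: add scale)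
  ultimately show ?thesis
    by (simp add: add_eq_0_iff2 flip: right_diff_distrib)
qed

lemma positive_operator_bounded_clinear: "positive_operator T \<Longrightarrow> bounded_clinear T"
  by (simp add: positive_operator_def)

lemma positive_operator_nonneg: "positive_operator T \<Longrightarrow> 0 \<le> inner x (T x)"
  by (simp add: positive_operator_def inner_eq_Re_cinner)

lemma positive_operator_cinner:
  "positive_operator T \<Longrightarrow> cinner x (T x) = of_real (inner x (T x))"
  by (simp add: positive_operator_def inner_eq_Re_cinner)

lemma bounded_clinear_add_apply: "bounded_clinear T \<Longrightarrow> T (x + y) = T x + T y"
  using bounded_clinearD(1) linear_add bounded_linear.linear by blast

lemma bounded_clinear_diff_apply: "bounded_clinear T \<Longrightarrow> T (x - y) = T x - T y"
  using bounded_clinearD(1) linear_diff bounded_linear.linear by blast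

text \<open>A real quadratic form equals its conjugate, so the sesquilinear form
  \<open>cinner (T x) y - cinner x (T y)\<close> vanishes on the diagonal.\<close>

lemma positive_operator_symmetric:
  assumes T: "positive_operator T"
  shows "cinner (T x) y = cinner x (T y)"
proof -
  note lin = positive_operator_bounded_clinear[OF T]
  have "cinner (T x) y - cinner x (T y) = 0"
  proof (rule sesquilinear_eq_0[where D = "\<lambda>x y. cinner (T x) y - cinner x (T y)"])
    fix x
    have "cinner (T x) x = cnj (cinner x (T x))"
      by (rule cinner_commute)
    then show "cinner (T x) x - cinner x (T x) = 0"
      by (simp add: positive_operator_cinner[OF T])
  qed (simp_all add: bounded_clinear_add_apply[OF lin] bounded_clinearD(2)[OF lin] cinner.add_left
      cinner.add_right cinner_scaleC_left cinner_scaleC_right right_diff_distrib)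
  then show ?thesis by simp
qed

lemma positive_operator_inner_symmetric:
  "positive_operator T \<Longrightarrow> inner (T x) y = inner x (T y)"
  by (simp add: inner_eq_Re_cinner positive_operator_symmetric)

lemma positive_operatorI:
  assumes "bounded_clinear T" and sym: "\<And>x y. cinner (T x) y = cinner x (T y)"
    and "\<And>x. 0 \<le> inner x (T x)"
  shows "positive_operator T"
proof -
  have "cinner x (T x) \<in> \<real>" for x
    using sym[of x x] cinner_commute[of "T x" x] by (metis Reals_cnj_iff)
  then show ?thesis
    using assms by (simp add: positive_operator_def inner_eq_Re_cinner)
qed

text \<open>Polarisation of \<open>S - T\<close>. This device lifts identities between scalar
  measures to identities between operators.\<close>

lemma positive_operator_eqI:
  assumes S: "positive_operator S" and T: "positive_operator T"
    and eq: "\<And>x. inner x (S x) = inner x (T x)"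
  shows "S = T"
proof
  fix y
  note lin = S[THEN positive_operator_bounded_clinear] T[THEN positive_operator_bounded_clinear]
  have "cinner (S y - T y) (S y - T y) = 0"
  proof (rule sesquilinear_eq_0[where D = "\<lambda>x y. cinner x (S y - T y)"])
    show "cinner x (S x - T x) = 0" for x
      by (simp add: cinner.diff_right positive_operator_cinner S T eq)
  qed (simp_all add: bounded_clinear_add_apply[OF lin(1)] bounded_clinear_add_apply[OF lin(2)]
      bounded_clinearD(2)[OF lin(1)] bounded_clinearD(2)[OF lin(2)] cinner.add_left
      cinner.add_right cinner.diff_right cinner_scaleC_left cinner_scaleC_right right_diff_distrib)
  then show "S y = T y"
    by (simp add: cinner_self)
qed

lemma positive_operator_add:
  assumes S: "positive_operator S" and T: "positive_operator T"
  shows "positive_operator (\<lambda>x. S x + T x)"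
proof (rule positive_operatorI)
  show "bounded_clinear (\<lambda>x. S x + T x)"
    using S T by (auto simp: positive_operator_def bounded_clinear_def bounded_linear_add scaleC_add_right)
qed (simp_all add: cinner.add_left cinner.add_right positive_operator_symmetric S T inner_add_right
    positive_operator_nonneg)

lemma positive_operator_sum:
  assumes "\<And>i. i \<in> I \<Longrightarrow> positive_operator (T i)"
  shows "positive_operator (\<lambda>x. \<Sum>i\<in>I. T i x)"
proof (rule positive_operatorI)
  show "bounded_clinear (\<lambda>x. \<Sum>i\<in>I. T i x)"
    using assms by (intro bounded_clinear_sum positive_operator_bounded_clinear)
qed (use assms in \<open>auto simp: cinner.sum_left cinner.sum_right positive_operator_symmetric
      inner_sum_right intro!: sum.cong sum_nonneg positive_operator_nonneg\<close>)

text \<open>The order interval \<open>0 \<le> T \<le> I\<close>, encoded so that it is visibly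
  stable under \<open>T \<mapsto> I - T\<close>.\<close>

definition effect :: "('h::complex_inner \<Rightarrow> 'h) \<Rightarrow> bool" where
  "effect T \<longleftrightarrow> positive_operator T \<and> positive_operator (\<lambda>x. x - T x)"

lemma effectI:
  assumes T: "positive_operator T" and le: "\<And>x. inner x (T x) \<le> inner x x"
  shows "effect T"
  unfolding effect_def
proof (intro conjI T positive_operatorI)
  show "bounded_clinear (\<lambda>x. x - T x)"
    using bounded_clinear_diff[OF bounded_clinear_id positive_operator_bounded_clinear[OF T]] by simp
qed (use le in \<open>simp_all add: cinner.diff_left cinner.diff_right positive_operator_symmetric[OF T]
      inner_diff_right\<close>)

lemma effect_positive: "effect T \<Longrightarrow> positive_operator T"
  by (simp add: effect_def)

lemma effect_le: "effect T \<Longrightarrow> inner x (T x) \<le> inner x x"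
  using positive_operator_nonneg[of "\<lambda>x. x - T x" x] by (simp add: effect_def inner_diff_right)

lemma effect_compl: "effect T \<Longrightarrow> effect (\<lambda>x. x - T x)"
  by (simp add: effect_def)

text \<open>One step of the recursion used for products of commuting effects; its lower bound,
  \<open>T\<^sup>2 \<le> T\<close>, also yields the norm estimates for effects.\<close>

lemma effect_diff_square:
  assumes T: "effect T"
  shows "effect (\<lambda>x. T x - T (T x))"
proof (rule effectI[OF positive_operatorI])
  note pos = effect_positive[OF T]
  note lin = positive_operator_bounded_clinear[OF pos]
  note sym = positive_operator_inner_symmetric[OF pos]
  show "bounded_clinear (\<lambda>x. T x - T (T x))"
    using bounded_clinear_diff[OF lin bounded_clinear_compose[OF lin lin]] by (simp add: o_def)
  show "cinner (T x - T (T x)) y = cinner x (T y - T (T y))" for x y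
    by (simp add: cinner.diff_left cinner.diff_right positive_operator_symmetric[OF pos])
  show "0 \<le> inner x (T x - T (T x))" for x
  proof -
    \<comment> \<open>\<open>T - T\<^sup>2 = T (I - T) T + (I - T) T (I - T)\<close>\<close>
    have "0 \<le> inner (T x) (T x - T (T x)) + inner (x - T x) (T (x - T x))"
      using positive_operator_nonneg[OF pos, of "x - T x"] effect_le[OF T, of "T x"]
      by (simp add: inner_diff_right)
    also have "\<dots> = inner x (T x - T (T x))"
      by (simp add: bounded_clinear_diff_apply[OF lin] inner_diff_left inner_diff_right sym)
    finally show ?thesis .
  qed
  show "inner x (T x - T (T x)) \<le> inner x x" for x
    using effect_le[OF T, of x] inner_ge_zero[of "T x"] by (simp add: inner_diff_right sym)
qed

lemma effect_norm_square_le: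
  assumes T: "effect T"
  shows "(norm (T x))\<^sup>2 \<le> inner x (T x)"
  using positive_operator_nonneg[OF effect_positive[OF effect_diff_square[OF T]], of x]
  by (simp add: inner_diff_right power2_norm_eq_inner
      positive_operator_inner_symmetric[OF effect_positive[OF T]])

lemma effect_norm_le:
  assumes T: "effect T"
  shows "norm (T x) \<le> norm x"
proof -
  have "norm (T x) * norm (T x) \<le> norm x * norm (T x)"
    using effect_norm_square_le[OF T, of x] norm_cauchy_schwarz[of x "T x"]
    by (simp add: power2_eq_square)
  then show ?thesis
    by (cases "T x = 0") auto
qed

text \<open>With \<open>T\<^sub>0 = T\<close> and \<open>T\<^bsub>k+1\<^esub> = T\<^sub>k - T\<^sub>k\<^sup>2\<close> one has \<open>T = \<Sum>\<^sub>k T\<^sub>k\<^sup>2\<close> strongly, whence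
  \<open>\<langle>x, S T x\<rangle> = \<Sum>\<^sub>k \<langle>T\<^sub>k x, S T\<^sub>k x\<rangle> \<ge> 0\<close>; this avoids square roots of operators.\<close>

lemma commuting_effects_compose_positive:
  assumes S: "effect S" and T: "effect T" and comm: "S \<circ> T = T \<circ> S"
  shows "positive_operator (S \<circ> T)"
proof (rule positive_operatorI)
  note posS = effect_positive[OF S] and posT = effect_positive[OF T]
  note linS = positive_operator_bounded_clinear[OF posS]
  show "bounded_clinear (S \<circ> T)"
    by (intro bounded_clinear_compose positive_operator_bounded_clinear posS posT)
  show "cinner ((S \<circ> T) x) y = cinner x ((S \<circ> T) y)" for x y
    by (subst (2) comm) (simp add: positive_operator_symmetric posS posT)
  fix x
  define t where "t k = ((\<lambda>T x. T x - T (T x)) ^^ k) T" for k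
  have t_Suc: "t (Suc k) y = t k y - t k (t k y)" for k y
    by (simp add: t_def)
  have eff: "effect (t k)" for k
    by (induction k) (auto simp: t_def T intro: effect_diff_square)
  have t_comm: "S (t k y) = t k (S y)" for k y
  proof (induction k arbitrary: y)
    case 0
    then show ?case using comm by (simp add: t_def fun_eq_iff)
  next
    case (Suc k)
    then show ?case by (simp add: t_Suc bounded_clinear_diff_apply[OF linS])
  qed
  have tsym: "inner (t k y) z = inner y (t k z)" for k y z
    by (rule positive_operator_inner_symmetric[OF effect_positive[OF eff]])
  \<comment> \<open>Telescoping, as \<open>t k - t (Suc k)\<close> is the square of
    \<open>t k\<close>. Bounded partial sums force \<open>t k x\<close> to tend to 0.\<close>
  have sq: "(\<Sum>k<n. (norm (t k x))\<^sup>2) = inner x (T x) - inner x (t n x)" for n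
    by (induction n) (simp_all add: t_Suc inner_diff_right power2_norm_eq_inner tsym t_def[of 0])
  have "summable (\<lambda>k. (norm (t k x))\<^sup>2)"
    using positive_operator_nonneg[OF effect_positive[OF eff]]
    by (intro summableI_nonneg_bounded[of _ "inner x (T x)"]) (simp_all add: sq)
  then have "(\<lambda>k. norm (t k x)) \<longlonglongrightarrow> 0"
    using tendsto_real_sqrt[OF summable_LIMSEQ_zero] by fastforce
  then have "(\<lambda>k. t k x) \<longlonglongrightarrow> 0"
    by (rule tendsto_norm_zero_cancel)
  then have "(\<lambda>k. inner x (S (t k x))) \<longlonglongrightarrow> inner x (S 0)"
    using bounded_clinearD(1)[OF linS]
    by (intro tendsto_intros bounded_linear.tendsto[of S])
  then have lim: "(\<lambda>k. inner x (S (t k x))) \<longlonglongrightarrow> 0"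
    using bounded_clinear_diff_apply[OF linS, of 0 0] by simp
  \<comment> \<open>The same telescoping after applying \<open>S\<close>: commutation lets one
    factor \<open>t k\<close> move to the left slot, so each term is a value of the quadratic form
    of \<open>S\<close>.\<close>
  have "inner x (S (T x)) - inner x (S (t n x)) = (\<Sum>k<n. inner (t k x) (S (t k x)))" for n
  proof (induction n)
    case (Suc n)
    then show ?case
      by (simp add: t_Suc tsym t_comm[symmetric] bounded_clinear_diff_apply[OF linS] inner_diff_right
          algebra_simps)
  qed (simp add: t_def)
  moreover have "(\<Sum>k<n. inner (t k x) (S (t k x))) \<ge> 0" for n
    by (intro sum_nonneg positive_operator_nonneg posS)
  ultimately have "inner x (S (t n x)) \<le> inner x (S (T x))" for n
    by (metis diff_ge_0_iff_ge)
  then show "0 \<le> inner x ((S \<circ> T) x)"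
    using LIMSEQ_le_const2[OF lim] by auto
qed

text \<open>The defining identities and inequalities pass to pointwise limits; boundedness survives
  because \<open>effect_norm_le\<close> gives the constant 1 for every \<open>n\<close>.\<close>

lemma strong_limit_of_effects:
  assumes T: "\<And>n. effect (T n)" and lim: "\<And>x. (\<lambda>n. T n x) \<longlonglongrightarrow> L x"
  shows "effect L"
proof (rule effectI[OF positive_operatorI])
  note pos = effect_positive[OF T]
  note lin = positive_operator_bounded_clinear[OF pos]
  have "L (x + y) = L x + L y" for x y
    using LIMSEQ_unique[OF lim[of "x + y"]] tendsto_add[OF lim[of x] lim[of y]]
    by (simp add: bounded_clinear_add_apply[OF lin])
  moreover have L: "L (a *\<^sub>C x) = a *\<^sub>C L x" for a x
    using LIMSEQ_unique[OF lim[of "a *\<^sub>C x"]] scaleC.tendsto[OF tendsto_const lim[of x], of a]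
    by (simp add: bounded_clinearD[OF lin])
  moreover have "norm (L x) \<le> norm x * 1" for x
    using LIMSEQ_le_const2[OF tendsto_norm[OF lim[of x]]] effect_norm_le[OF T] by auto
  ultimately show "bounded_clinear L"
    unfolding bounded_clinear_def
    by (auto intro!: bounded_linear_intro[of L 1] simp: scaleR_scaleC)
  show "cinner (L x) y = cinner x (L y)" for x y
    using LIMSEQ_unique[OF cinner.tendsto[OF lim[of x] tendsto_const[of y]]
        cinner.tendsto[OF tendsto_const[of x] lim[of y], folded positive_operator_symmetric[OF pos]]] .
  have in_lim: "(\<lambda>n. inner x (T n x)) \<longlonglongrightarrow> inner x (L x)" for x
    by (intro tendsto_intros lim)
  show "0 \<le> inner x (L x)" for x
    using LIMSEQ_le_const[OF in_lim] positive_operator_nonneg[OF pos] by auto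
  show "inner x (L x) \<le> inner x x" for x
    using LIMSEQ_le_const2[OF in_lim] effect_le[OF T] by auto
qed

text \<open>A block of the series lies below a partial sum, so it is an effect, and its squared norm
  at \<open>x\<close> is at most the same block of the bounded series
  \<open>inner x (A k x)\<close>. Hence the partial sums are Cauchy.\<close>

lemma effect_sums:
  fixes A :: "nat \<Rightarrow> 'h::chilbert_space \<Rightarrow> 'h"
  assumes pos: "\<And>k. positive_operator (A k)" and eff: "\<And>n. effect (\<lambda>x. \<Sum>k<n. A k x)"
  obtains L where "effect L" "\<And>x. (\<lambda>k. A k x) sums L x"
proof -
  have "summable (\<lambda>k. A k x)" for x
  proof -
    have bound: "(\<Sum>k<n. inner x (A k x)) \<le> inner x x" for n
      using effect_le[OF eff[of n], of x] by (simp add: inner_sum_right)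
    have "summable (\<lambda>k. inner x (A k x))"
      by (rule summableI_nonneg_bounded[OF positive_operator_nonneg[OF pos] bound])
    then have "Cauchy (\<lambda>n. \<Sum>k<n. inner x (A k x))"
      by (simp add: summable_iff_convergent convergent_Cauchy)
    have diff: "(norm ((\<Sum>k<n. A k x) - (\<Sum>k<m. A k x)))\<^sup>2
        \<le> norm ((\<Sum>k<n. inner x (A k x)) - (\<Sum>k<m. inner x (A k x)))" if "m \<le> n" for m n
    proof -
      have *: "sum f {..<n} - sum f {..<m} = sum f {m..<n}" for f :: "nat \<Rightarrow> 'z::ab_group_add"
        using that by (metis atLeast0LessThan le0 sum_diff_nat_ivl)
      have "effect (\<lambda>x. \<Sum>k\<in>{m..<n}. A k x)"
      proof (rule effectI[OF positive_operator_sum[OF pos]])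
        fix x
        have "inner x (\<Sum>k\<in>{m..<n}. A k x) \<le> inner x (\<Sum>k<n. A k x)"
          unfolding inner_sum_right
          by (intro sum_mono2) (auto intro: positive_operator_nonneg[OF pos])
        also have "\<dots> \<le> inner x x"
          by (rule effect_le[OF eff])
        finally show "inner x (\<Sum>k\<in>{m..<n}. A k x) \<le> inner x x" .
      qed
      from effect_norm_square_le[OF this, of x] show ?thesis
        unfolding * by (simp add: inner_sum_right)
    qed
    have "Cauchy (\<lambda>n. \<Sum>k<n. A k x)"
    proof (rule metric_CauchyI)
      fix e :: real assume "e > 0"
      then obtain N where N: "\<And>m n. m \<ge> N \<Longrightarrow> n \<ge> N \<Longrightarrow>
          norm ((\<Sum>k<n. inner x (A k x)) - (\<Sum>k<m. inner x (A k x))) < e\<^sup>2"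
        using CauchyD[OF \<open>Cauchy _\<close>, of "e\<^sup>2"] by auto
      have *: "norm ((\<Sum>k<n. A k x) - (\<Sum>k<m. A k x)) < e" if "N \<le> m" "m \<le> n" for m n
        using order_le_less_trans[OF diff[OF that(2)] N] that \<open>e > 0\<close>
        by (intro power2_less_imp_less[of _ e]) auto
      have "dist (\<Sum>k<m. A k x) (\<Sum>k<n. A k x) < e" if "N \<le> m" "N \<le> n" for m n
        using *[of m n] *[of n m] that by (cases "m \<le> n") (auto simp: dist_norm norm_minus_commute)
      then show "\<exists>M. \<forall>m\<ge>M. \<forall>n\<ge>M. dist (\<Sum>k<m. A k x) (\<Sum>k<n. A k x) < e"
        by blast
    qed
    then show ?thesis
      by (simp add: summable_iff_convergent Cauchy_convergent)
  qed
  then have sums: "(\<lambda>k. A k x) sums (\<Sum>k. A k x)" for x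
    by (rule summable_sums)
  then have "effect (\<lambda>x. \<Sum>k. A k x)"
    by (intro strong_limit_of_effects[OF eff]) (simp add: sums_def)
  with sums that show thesis by blast
qed

section \<open>Regularity of finite Borel measures\<close>

lemma space_borel_of [simp]: "space (borel_of X) = topspace X"
  and sets_borel_of: "sets (borel_of X) = sigma_sets (topspace X) {U. openin X U}"
proof -
  have "{U. openin X U} \<subseteq> Pow (topspace X)"
    by (auto dest: openin_subset)
  then show "space (borel_of X) = topspace X"
    "sets (borel_of X) = sigma_sets (topspace X) {U. openin X U}"
    by (simp_all add: borel_of_def)
qed

lemma openin_borel_of: "openin X U \<Longrightarrow> U \<in> sets (borel_of X)"
  by (auto simp: sets_borel_of)

lemma topspace_in_borel_of [simp]: "topspace X \<in> sets (borel_of X)"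
  by (simp add: openin_borel_of)

lemma closedin_borel_of:
  assumes "closedin X K"
  shows "K \<in> sets (borel_of X)"
proof -
  have "space (borel_of X) - (topspace X - K) \<in> sets (borel_of X)"
    using assms by (intro sets.compl_sets openin_borel_of openin_diff) auto
  moreover have "space (borel_of X) - (topspace X - K) = K"
    using closedin_subset[OF assms] by auto
  ultimately show ?thesis by metis
qed

text \<open>Regularity puts around each point of \<open>U\<close> an open set whose closure stays in
  \<open>U\<close>, and a basic set inside it inherits this; there are only countably many basic
  sets.\<close>

lemma open_eq_Union_closed:
  assumes "second_countable X" "regular_space X" "openin X U"
  obtains C :: "nat \<Rightarrow> 'a set" where "\<And>n. closedin X (C n)" "(\<Union>n. C n) = U"
proof -
  obtain \<B> where \<B>: "countable \<B>" "\<And>V. V \<in> \<B> \<Longrightarrow> openin X V"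
    "\<And>W x. openin X W \<Longrightarrow> x \<in> W \<Longrightarrow> \<exists>V\<in>\<B>. x \<in> V \<and> V \<subseteq> W"
    using assms(1) by (auto simp: second_countable_def)
  \<comment> \<open>The empty set keeps the family nonempty, as the enumeration
    \<open>from_nat_into\<close> requires.\<close>
  define \<C> where "\<C> = insert {} {X closure_of V |V. V \<in> \<B> \<and> X closure_of V \<subseteq> U}"
  have "\<C> = insert {} ((closure_of) X ` {V \<in> \<B>. X closure_of V \<subseteq> U})"
    by (auto simp: \<C>_def)
  then have "countable \<C>"
    using \<B>(1) by (simp add: countable_image countable_Collect)
  have "\<exists>C\<in>\<C>. x \<in> C" if "x \<in> U" for x
  proof -
    have "closedin X (topspace X - U)" "x \<in> topspace X - (topspace X - U)"
      using assms(3) that openin_subset[OF assms(3)] by auto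
    then obtain W where W: "openin X W" "x \<in> W" "disjnt (topspace X - U) (X closure_of W)"
      using assms(2) unfolding regular_space by blast
    obtain V where V: "V \<in> \<B>" "x \<in> V" "V \<subseteq> W"
      using \<B>(3)[OF W(1,2)] by blast
    have "X closure_of V \<subseteq> X closure_of W"
      by (rule closure_of_mono) fact
    then have "X closure_of V \<subseteq> U"
      using W(3) closure_of_subset_topspace[of X V] by (auto simp: disjnt_def)
    moreover have "x \<in> X closure_of V"
      using closure_of_subset[of V X] openin_subset[OF \<B>(2)[OF V(1)]] V by auto
    ultimately show ?thesis
      using V by (auto simp: \<C>_def)
  qed
  moreover have "\<Union>\<C> \<subseteq> U"
    by (auto simp: \<C>_def)
  ultimately have "\<Union>\<C> = U" by blast
  moreover have "range (from_nat_into \<C>) = \<C>"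
    using \<open>countable \<C>\<close> by (intro range_from_nat_into) (auto simp: \<C>_def)
  moreover have "closedin X C" if "C \<in> \<C>" for C
    using that by (auto simp: \<C>_def)
  moreover have "from_nat_into \<C> n \<in> \<C>" for n
    by (rule from_nat_into) (auto simp: \<C>_def)
  ultimately show thesis
    using that[of "from_nat_into \<C>"] by metis
qed

text \<open>The sets that can be squeezed in this way form a \<sigma>-algebra; it contains the open
  sets because each is an increasing limit of closed ones.\<close>

lemma finite_borel_measure_regular:
  assumes X: "second_countable X" "regular_space X"
    and \<mu>: "finite_measure \<mu>" "sets \<mu> = sets (borel_of X)" and A: "A \<in> sets (borel_of X)"
    and "\<epsilon> > 0"
  shows "\<exists>K U. closedin X K \<and> openin X U \<and> K \<subseteq> A \<and> A \<subseteq> U \<and> measure \<mu> (U - K) < \<epsilon>"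
proof -
  interpret finite_measure \<mu> by fact
  have op: "U \<in> sets \<mu>" if "openin X U" for U
    using openin_borel_of[OF that] \<mu> by metis
  have cl: "K \<in> sets \<mu>" if "closedin X K" for K
    using closedin_borel_of[OF that] \<mu> by metis
  have "A \<in> sigma_sets (topspace X) {U. openin X U}"
    using A by (simp add: sets_borel_of)
  then show ?thesis
    using \<open>\<epsilon> > 0\<close>
  proof (induction A arbitrary: \<epsilon>)
    case (Basic U)
    then have U: "openin X U" by simp
    obtain C :: "nat \<Rightarrow> 'a set" where C: "\<And>n. closedin X (C n)" "(\<Union>n. C n) = U"
      using open_eq_Union_closed[OF X U] by blast
    define D where "D n = (\<Union>i\<le>n. C i)" for n
    have D: "closedin X (D n)" for n
      unfolding D_def by (intro closedin_Union) (auto simp: C)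
    have "decseq (\<lambda>n. U - D n)"
      by (force simp: D_def decseq_def)
    then have "(\<lambda>n. measure \<mu> (U - D n)) \<longlonglongrightarrow> measure \<mu> (\<Inter>n. U - D n)"
      using op[OF U] cl[OF D] by (intro finite_Lim_measure_decseq) auto
    moreover have "(\<Inter>n. U - D n) = {}"
      using C(2) by (auto simp: D_def)
    ultimately have "(\<lambda>n. measure \<mu> (U - D n)) \<longlonglongrightarrow> 0"
      by (simp only: measure_empty)
    then have "\<forall>\<^sub>F n in sequentially. measure \<mu> (U - D n) < \<epsilon>"
      using Basic.prems by (rule order_tendstoD(2))
    then obtain n where "measure \<mu> (U - D n) < \<epsilon>"
      by (auto simp: eventually_sequentially)
    then show ?case
      using D[of n] U C(2) by (intro exI[of _ "D n"] exI[of _ U]) (auto simp: D_def)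
  next
    case Empty
    then show ?case
      by (intro exI[of _ "{}"]) auto
  next
    case (Compl A)
    obtain K U where KU: "closedin X K" "openin X U" "K \<subseteq> A" "A \<subseteq> U" "measure \<mu> (U - K) < \<epsilon>"
      using Compl by meson
    \<comment> \<open>Complements exchange the closed and the open side and leave the gap
      unchanged.\<close>
    have "(topspace X - K) - (topspace X - U) = U - K"
      using openin_subset[OF KU(2)] by auto
    then show ?case
      using KU by (intro exI[of _ "topspace X - U"] exI[of _ "topspace X - K"]) auto
  next
    case (Union A)
    \<comment> \<open>These gaps add up to at most \<open>\<epsilon> / 2\<close>; the strict slack
      left below \<epsilon> pays for keeping only finitely many of the \<open>K n\<close>.\<close>
    have "\<exists>K U. closedin X K \<and> openin X U \<and> K \<subseteq> A n \<and> A n \<subseteq> U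
        \<and> measure \<mu> (U - K) < \<epsilon> / 2 * (1 / 2) ^ Suc n" for n
      using Union by (intro Union.IH) auto
    then obtain K U where K: "\<And>n. closedin X (K n)" and U: "\<And>n. openin X (U n)"
      and sub: "\<And>n. K n \<subseteq> A n" "\<And>n. A n \<subseteq> U n"
      and less: "\<And>n. measure \<mu> (U n - K n) < \<epsilon> / 2 * (1 / 2) ^ Suc n"
      by metis
    have sums: "(\<lambda>n. \<epsilon> / 2 * (1 / 2) ^ Suc n) sums (\<epsilon> / 2 * 1)"
      by (intro sums_mult power_half_series)
    have summ: "summable (\<lambda>n. measure \<mu> (U n - K n))"
      by (rule summable_comparison_test'[OF sums_summable[OF sums]]) (use less in \<open>simp add: less_imp_le\<close>)
    have "measure \<mu> (\<Union>n. U n - K n) \<le> (\<Sum>n. measure \<mu> (U n - K n))"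
      using op[OF U] cl[OF K] summ by (intro finite_measure_subadditive_countably) auto
    also have "\<dots> \<le> (\<Sum>n. \<epsilon> / 2 * (1 / 2) ^ Suc n)"
      using less by (intro suminf_le summ sums_summable[OF sums]) (auto intro: less_imp_le)
    also have "\<dots> = \<epsilon> / 2"
      using sums_unique[OF sums] by simp
    finally have small: "measure \<mu> (\<Union>n. U n - K n) \<le> \<epsilon> / 2" .
    define V where "V = (\<Union>n. U n)"
    \<comment> \<open>The union of all \<open>K i\<close> need not be closed; finite unions are, and
      continuity from above controls the loss.\<close>
    define L where "L n = (\<Union>i\<le>n. K i)" for n
    have V: "openin X V"
      unfolding V_def using U by auto
    have L: "closedin X (L n)" for n
      unfolding L_def by (intro closedin_Union) (auto simp: K)
    have "decseq (\<lambda>n. V - L n)"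
      by (force simp: L_def decseq_def)
    then have "(\<lambda>n. measure \<mu> (V - L n)) \<longlonglongrightarrow> measure \<mu> (\<Inter>n. V - L n)"
      using op[OF V] cl[OF L] by (intro finite_Lim_measure_decseq) auto
    moreover have "measure \<mu> (\<Inter>n. V - L n) < \<epsilon>"
    proof -
      have "(\<Inter>n. V - L n) \<subseteq> (\<Union>n. U n - K n)"
        by (auto simp: V_def L_def)
      then have "measure \<mu> (\<Inter>n. V - L n) \<le> measure \<mu> (\<Union>n. U n - K n)"
        using op[OF U] cl[OF K] by (intro finite_measure_mono) auto
      with small \<open>\<epsilon> > 0\<close> show ?thesis by linarith
    qed
    ultimately have "\<forall>\<^sub>F n in sequentially. measure \<mu> (V - L n) < \<epsilon>"
      by (rule order_tendstoD(2))
    then obtain n where "measure \<mu> (V - L n) < \<epsilon>"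
      by (auto simp: eventually_sequentially)
    moreover have "L n \<subseteq> \<Union>(range A)" "\<Union>(range A) \<subseteq> V"
      using sub by (fastforce simp: L_def V_def)+
    ultimately show ?case
      by (intro exI[of _ "L n"] exI[of _ V] conjI V L)
  qed
qed

section \<open>Bimeasures\<close>

definition represents :: "'a measure \<Rightarrow> ('a set \<Rightarrow> real) \<Rightarrow> 'a measure \<Rightarrow> bool" where
  "represents M m \<mu> \<longleftrightarrow> finite_measure \<mu> \<and> sets \<mu> = sets M \<and> (\<forall>A\<in>sets M. measure \<mu> A = m A)"

lemma representsD:
  assumes "represents M m \<mu>"
  shows "finite_measure \<mu>" "sets \<mu> = sets M" "space \<mu> = space M"
    "A \<in> sets M \<Longrightarrow> measure \<mu> A = m A"
  using assms sets_eq_imp_space_eq[of \<mu> M] by (auto simp: represents_def)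

text \<open>The classical notion: countable additivity in each variable separately. Nonnegativity
  comes for free, as the sections are measures.\<close>

locale bimeasure =
  fixes M :: "'x measure" and N :: "'y measure" and \<beta> :: "'x set \<Rightarrow> 'y set \<Rightarrow> real"
  assumes left: "\<And>\<theta>. \<theta> \<in> sets N \<Longrightarrow> \<exists>\<mu>. represents M (\<lambda>\<delta>. \<beta> \<delta> \<theta>) \<mu>"
    and right: "\<And>\<delta>. \<delta> \<in> sets M \<Longrightarrow> \<exists>\<nu>. represents N (\<lambda>\<theta>. \<beta> \<delta> \<theta>) \<nu>"
begin

lemma nonneg: "\<delta> \<in> sets M \<Longrightarrow> \<theta> \<in> sets N \<Longrightarrow> 0 \<le> \<beta> \<delta> \<theta>"
  using left by (metis measure_nonneg representsD(4))

lemma empty: "\<delta> \<in> sets M \<Longrightarrow> \<beta> \<delta> {} = 0" "\<theta> \<in> sets N \<Longrightarrow> \<beta> {} \<theta> = 0"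
  using left right by (metis measure_empty representsD(4) sets.empty_sets)+

lemma diff_left:
  assumes "\<delta> \<in> sets M" "\<delta>' \<in> sets M" "\<delta>' \<subseteq> \<delta>" "\<theta> \<in> sets N"
  shows "\<beta> (\<delta> - \<delta>') \<theta> = \<beta> \<delta> \<theta> - \<beta> \<delta>' \<theta>"
proof -
  obtain \<mu> where \<mu>: "represents M (\<lambda>\<delta>. \<beta> \<delta> \<theta>) \<mu>"
    using left assms by blast
  show ?thesis
    using finite_measure.finite_measure_Diff[OF representsD(1)[OF \<mu>], of \<delta> \<delta>'] assms
    by (simp add: representsD[OF \<mu>])
qed

lemma diff_right:
  assumes "\<theta> \<in> sets N" "\<theta>' \<in> sets N" "\<theta>' \<subseteq> \<theta>" "\<delta> \<in> sets M"
  shows "\<beta> \<delta> (\<theta> - \<theta>') = \<beta> \<delta> \<theta> - \<beta> \<delta> \<theta>'"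
proof -
  obtain \<nu> where \<nu>: "represents N (\<lambda>\<theta>. \<beta> \<delta> \<theta>) \<nu>"
    using right assms by blast
  show ?thesis
    using finite_measure.finite_measure_Diff[OF representsD(1)[OF \<nu>], of \<theta> \<theta>'] assms
    by (simp add: representsD[OF \<nu>])
qed

lemma mono:
  assumes "\<delta> \<in> sets M" "\<delta>' \<in> sets M" "\<delta>' \<subseteq> \<delta>" "\<theta> \<in> sets N" "\<theta>' \<in> sets N" "\<theta>' \<subseteq> \<theta>"
  shows "\<beta> \<delta>' \<theta>' \<le> \<beta> \<delta> \<theta>"
  using diff_left[OF assms(1-3,5)] diff_right[OF assms(4-6,1)]
    nonneg[of "\<delta> - \<delta>'" \<theta>'] nonneg[of \<delta> "\<theta> - \<theta>'"] assms by auto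

lemma finite_Union_right:
  assumes "finite I" "\<And>i. i \<in> I \<Longrightarrow> T i \<in> sets N" "disjoint_family_on T I" "\<delta> \<in> sets M"
  shows "\<beta> \<delta> (\<Union>i\<in>I. T i) = (\<Sum>i\<in>I. \<beta> \<delta> (T i))"
proof -
  obtain \<nu> where \<nu>: "represents N (\<lambda>\<theta>. \<beta> \<delta> \<theta>) \<nu>"
    using right assms by blast
  have "(\<Union>i\<in>I. T i) \<in> sets N"
    using assms by auto
  then show ?thesis
    using finite_measure.finite_measure_finite_Union[OF representsD(1)[OF \<nu>], of I T] assms
    by (auto simp: representsD[OF \<nu>] image_subset_iff)
qed

text \<open>The integral of a simple function on rectangles against \<open>\<beta>\<close> is monotone. On each atom of
  the algebra generated by the \<open>t i\<close> this is monotonicity of an honest integral over the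
  first variable.\<close>

lemma rectangle_sum_nonneg:
  fixes c :: "'i \<Rightarrow> real"
  assumes I: "finite I" and d: "\<And>i. i \<in> I \<Longrightarrow> d i \<in> sets M" and t: "\<And>i. i \<in> I \<Longrightarrow> t i \<in> sets N"
    and pos: "\<And>x y. x \<in> space M \<Longrightarrow> y \<in> space N \<Longrightarrow>
      0 \<le> (\<Sum>i\<in>I. c i * (indicator (d i) x * indicator (t i) y))"
  shows "0 \<le> (\<Sum>i\<in>I. c i * \<beta> (d i) (t i))"
proof -
  \<comment> \<open>For \<open>J \<subseteq> I\<close> these are the atoms: points lying in
    \<open>t i\<close> for exactly the \<open>i \<in> J\<close>. Each \<open>t i\<close> is a
    disjoint union of them.\<close>
  define T where "T J = {y \<in> space N. \<forall>i\<in>I. y \<in> t i \<longleftrightarrow> i \<in> J}" for J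
  have T: "T J \<in> sets N" for J
    unfolding T_def
  proof (rule sets.sets_Collect_finite_All[OF _ I])
    fix i assume i: "i \<in> I"
    have "{y \<in> space N. y \<in> t i \<longleftrightarrow> i \<in> J} = (if i \<in> J then t i else space N - t i)"
      using sets.sets_into_space[OF t[OF i]] by auto
    then show "{y \<in> space N. y \<in> t i \<longleftrightarrow> i \<in> J} \<in> sets N"
      using t[OF i] by simp
  qed
  have split: "\<beta> (d i) (t i) = (\<Sum>J\<in>Pow I. if i \<in> J then \<beta> (d i) (T J) else 0)" if i: "i \<in> I" for i
  proof -
    have "t i = (\<Union>J\<in>{J \<in> Pow I. i \<in> J}. T J)"
    proof (intro equalityI subsetI)
      fix y assume "y \<in> t i"
      then show "y \<in> (\<Union>J\<in>{J \<in> Pow I. i \<in> J}. T J)"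
        using i sets.sets_into_space[OF t[OF i]]
        by (intro UN_I[of "{j \<in> I. y \<in> t j}"]) (auto simp: T_def)
    qed (use i in \<open>auto simp: T_def\<close>)
    moreover have "disjoint_family_on T {J \<in> Pow I. i \<in> J}"
      by (auto simp: disjoint_family_on_def T_def)
    ultimately have "\<beta> (d i) (t i) = (\<Sum>J\<in>{J \<in> Pow I. i \<in> J}. \<beta> (d i) (T J))"
      using finite_Union_right[of "{J \<in> Pow I. i \<in> J}" T "d i"] I T d[OF i] by simp
    then show ?thesis
      using I by (simp only: sum.inter_filter finite_Pow_iff)
  qed
  have "0 \<le> (\<Sum>i\<in>I. if i \<in> J then c i * \<beta> (d i) (T J) else 0)" for J
  \<comment> \<open>An empty atom offers no sample point \<open>y\<close>, but there every
    \<open>\<beta> (d i) (T J)\<close> is 0.\<close>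
  proof (cases "T J = {}")
    case True
    then show ?thesis
      using d empty(1) by (intro sum_nonneg) auto
  next
    case False
    then obtain y where y: "y \<in> space N" "\<And>i. i \<in> I \<Longrightarrow> y \<in> t i \<longleftrightarrow> i \<in> J"
      by (auto simp: T_def)
    obtain \<mu> where \<mu>: "represents M (\<lambda>\<delta>. \<beta> \<delta> (T J)) \<mu>"
      using left T by blast
    interpret \<mu>: finite_measure \<mu>
      using representsD[OF \<mu>] by blast
    \<comment> \<open>The indicators of the \<open>t i\<close> are constant on the atom, so freezing
      one \<open>y\<close> in it leaves a nonnegative function of \<open>x\<close> to integrate
      against the section at \<open>T J\<close>.\<close>
    have "0 \<le> (\<integral>x. (\<Sum>i\<in>I. c i * (indicator (d i) x * indicator (t i) y)) \<partial>\<mu>)"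
      using pos y representsD[OF \<mu>] by (intro integral_nonneg_AE AE_I2) auto
    also have "\<dots> = (\<Sum>i\<in>I. c i * (measure \<mu> (d i) * indicator (t i) y))"
      using d representsD[OF \<mu>] sets.sets_into_space[of _ M]
      by (subst Bochner_Integration.integral_sum)
        (auto intro!: sum.cong Bochner_Integration.integrable_mult_right
          Bochner_Integration.integrable_mult_left integrable_real_indicator
          simp: \<mu>.emeasure_finite less_top[symmetric] Int_absorb2)
    also have "\<dots> = (\<Sum>i\<in>I. if i \<in> J then c i * \<beta> (d i) (T J) else 0)"
      using y d representsD(4)[OF \<mu>] by (intro sum.cong) auto
    finally show ?thesis .
  qed
  then have "0 \<le> (\<Sum>J\<in>Pow I. \<Sum>i\<in>I. if i \<in> J then c i * \<beta> (d i) (T J) else 0)"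
    by (rule sum_nonneg)
  also have "\<dots> = (\<Sum>i\<in>I. c i * (\<Sum>J\<in>Pow I. if i \<in> J then \<beta> (d i) (T J) else 0))"
    by (subst sum.swap) (auto simp: sum_distrib_left intro!: sum.cong)
  also have "\<dots> = (\<Sum>i\<in>I. c i * \<beta> (d i) (t i))"
    using split by (intro sum.cong) auto
  finally show ?thesis .
qed

text \<open>Disjointness makes the indicator of the large rectangle minus those of the small ones
  nonnegative; \<open>rectangle_sum_nonneg\<close> integrates this.\<close>

lemma sum_rectangles_le:
  assumes d: "\<And>i. d i \<in> sets M" and t: "\<And>i. t i \<in> sets N" and \<delta>: "\<delta> \<in> sets M" and \<theta>: "\<theta> \<in> sets N"
    and disj: "disjoint_family (\<lambda>i::nat. d i \<times> t i)" and sub: "\<And>i. d i \<times> t i \<subseteq> \<delta> \<times> \<theta>"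
  shows "(\<Sum>i<n. \<beta> (d i) (t i)) \<le> \<beta> \<delta> \<theta>"
proof -
  \<comment> \<open>Index \<open>n\<close> carries the large rectangle, the indices below
    \<open>n\<close> the small ones with the opposite sign.\<close>
  let ?c = "\<lambda>i. if i < n then - 1 else 1 :: real"
  let ?d = "\<lambda>i. if i < n then d i else \<delta>" and ?t = "\<lambda>i. if i < n then t i else \<theta>"
  have "0 \<le> (\<Sum>i<Suc n. ?c i * \<beta> (?d i) (?t i))"
  proof (rule rectangle_sum_nonneg)
    fix x y
    have "(\<Sum>i<n. indicator (d i) x * indicator (t i) y) = (\<Sum>i<n. indicator (d i \<times> t i) (x, y) :: real)"
      by (simp add: indicator_times)
    also have "\<dots> = indicator (\<Union>i<n. d i \<times> t i) (x, y)"
      using disj by (intro indicator_UN_disjoint[symmetric]) (auto simp: disjoint_family_on_def)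
    also have "\<dots> \<le> indicator (\<delta> \<times> \<theta>) (x, y)"
    proof -
      have "(\<Union>i<n. d i \<times> t i) \<subseteq> \<delta> \<times> \<theta>"
        by (rule UN_least) (rule sub)
      then show ?thesis
        by (auto simp: indicator_def)
    qed
    finally show "0 \<le> (\<Sum>i<Suc n. ?c i * (indicator (?d i) x * indicator (?t i) y))"
      by (simp add: indicator_times sum_negf)
  qed (use d t \<delta> \<theta> in auto)
  then show ?thesis
    by (simp add: sum_negf)
qed

text \<open>The same device with signs reversed. Overlaps are allowed, since the lemma is applied to
  finite open covers.\<close>

lemma le_sum_rectangles:
  assumes d: "\<And>i. d i \<in> sets M" and t: "\<And>i. t i \<in> sets N" and \<delta>: "\<delta> \<in> sets M" and \<theta>: "\<theta> \<in> sets N"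
    and sub: "\<delta> \<times> \<theta> \<subseteq> (\<Union>i<n::nat. d i \<times> t i)"
  shows "\<beta> \<delta> \<theta> \<le> (\<Sum>i<n. \<beta> (d i) (t i))"
proof -
  let ?c = "\<lambda>i. if i < n then 1 else - 1 :: real"
  let ?d = "\<lambda>i. if i < n then d i else \<delta>" and ?t = "\<lambda>i. if i < n then t i else \<theta>"
  have "0 \<le> (\<Sum>i<Suc n. ?c i * \<beta> (?d i) (?t i))"
  proof (rule rectangle_sum_nonneg)
    fix x y
    have "indicator (\<delta> \<times> \<theta>) (x, y) \<le> (\<Sum>i<n. indicator (d i \<times> t i) (x, y) :: real)"
    proof (cases "(x, y) \<in> \<delta> \<times> \<theta>")
      case True
      then obtain i where i: "i < n" "(x, y) \<in> d i \<times> t i"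
        using sub by blast
      then have "(1::real) = indicator (d i \<times> t i) (x, y)"
        by simp
      also have "\<dots> \<le> (\<Sum>i<n. indicator (d i \<times> t i) (x, y))"
        using i by (intro member_le_sum) auto
      finally show ?thesis
        using True by simp
    qed (auto intro: sum_nonneg)
    then show "0 \<le> (\<Sum>i<Suc n. ?c i * (indicator (?d i) x * indicator (?t i) y))"
      by (simp add: indicator_times)
  qed (use d t \<delta> \<theta> in auto)
  then show ?thesis
    by simp
qed

end

lemma semiring_of_rectangles:
  "semiring_of_sets (space M \<times> space N) {a \<times> b |a b. a \<in> sets M \<and> b \<in> sets N}"
proof
  let ?R = "{a \<times> b |a b. a \<in> sets M \<and> b \<in> sets N}"
  show "?R \<subseteq> Pow (space M \<times> space N)"
    by (rule pair_measure_closed)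
  show "{} \<in> ?R"
    by blast
  fix A B assume "A \<in> ?R" "B \<in> ?R"
  then obtain a b c d where AB: "A = a \<times> b" "B = c \<times> d"
    and s: "a \<in> sets M" "b \<in> sets N" "c \<in> sets M" "d \<in> sets N"
    by blast
  show "A \<inter> B \<in> ?R"
    unfolding AB Times_Int_Times using s by blast
  \<comment> \<open>The first piece lies outside \<open>c\<close> in the first coordinate, the
    second inside \<open>c\<close>, which makes them disjoint.\<close>
  have "A - B = \<Union>{(a - c) \<times> b, (a \<inter> c) \<times> (b - d)}"
    unfolding AB by auto
  moreover have "{(a - c) \<times> b, (a \<inter> c) \<times> (b - d)} \<subseteq> ?R"
    using s by blast
  moreover have "disjoint {(a - c) \<times> b, (a \<inter> c) \<times> (b - d)}"
    by (auto simp: disjoint_def)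
  ultimately show "\<exists>C\<subseteq>?R. finite C \<and> disjoint C \<and> A - B = \<Union>C"
    by (meson finite.emptyI finite.insertI)
qed

locale borel_bimeasure = bimeasure "borel_of X" "borel_of Y" \<beta>
  for X :: "'x topology" and Y :: "'y topology" and \<beta> +
  assumes X: "second_countable X" "regular_space X" "compact_space X"
    and Y: "second_countable Y" "regular_space Y" "compact_space Y"
begin

text \<open>Shrinking \<open>U \<times> V\<close> to \<open>K \<times> L\<close> one side at a time
  loses \<open>\<beta> (U - K) V\<close> and then \<open>\<beta> K (V - L)\<close>; monotonicity
  bounds each loss by a marginal, so regularity of two ordinary measures is enough.\<close>

lemma approx:
  assumes \<delta>: "\<delta> \<in> sets (borel_of X)" and \<theta>: "\<theta> \<in> sets (borel_of Y)" and "\<epsilon> > 0"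
  shows "\<exists>K U L V. closedin X K \<and> openin X U \<and> K \<subseteq> \<delta> \<and> \<delta> \<subseteq> U \<and>
     closedin Y L \<and> openin Y V \<and> L \<subseteq> \<theta> \<and> \<theta> \<subseteq> V \<and> \<beta> U V < \<beta> K L + \<epsilon>"
proof -
  let ?M = "borel_of X" and ?N = "borel_of Y"
  obtain \<mu> where \<mu>: "represents ?M (\<lambda>\<delta>. \<beta> \<delta> (space ?N)) \<mu>"
    using left by blast
  obtain \<nu> where \<nu>: "represents ?N (\<lambda>\<theta>. \<beta> (space ?M) \<theta>) \<nu>"
    using right by blast
  obtain K U where KU: "closedin X K" "openin X U" "K \<subseteq> \<delta>" "\<delta> \<subseteq> U" "measure \<mu> (U - K) < \<epsilon> / 2"
    using finite_borel_measure_regular[OF X(1,2) representsD(1,2)[OF \<mu>] \<delta>, of "\<epsilon> / 2"] \<open>\<epsilon> > 0\<close>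
    by auto
  obtain L V where LV: "closedin Y L" "openin Y V" "L \<subseteq> \<theta>" "\<theta> \<subseteq> V" "measure \<nu> (V - L) < \<epsilon> / 2"
    using finite_borel_measure_regular[OF Y(1,2) representsD(1,2)[OF \<nu>] \<theta>, of "\<epsilon> / 2"] \<open>\<epsilon> > 0\<close>
    by auto
  have s: "K \<in> sets ?M" "U \<in> sets ?M" "L \<in> sets ?N" "V \<in> sets ?N"
    using KU LV by (intro openin_borel_of closedin_borel_of; simp)+
  then have s': "U - K \<in> sets ?M" "V - L \<in> sets ?N"
    by (auto)
  have "\<beta> U V - \<beta> K V = \<beta> (U - K) V"
    using KU s by (subst diff_left) (auto)
  also have "\<dots> \<le> \<beta> (U - K) (space ?N)"
    using s s' sets.sets_into_space[OF s(4)] by (intro mono) (auto)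
  also have "\<dots> < \<epsilon> / 2"
    using KU(5) representsD(4)[OF \<mu> s'(1)] by simp
  finally have 1: "\<beta> U V - \<beta> K V < \<epsilon> / 2" .
  have "\<beta> K V - \<beta> K L = \<beta> K (V - L)"
    using LV s by (subst diff_right) (auto)
  also have "\<dots> \<le> \<beta> (space ?M) (V - L)"
    using s s' sets.sets_into_space[OF s(1)] by (intro mono) (auto)
  also have "\<dots> < \<epsilon> / 2"
    using LV(5) representsD(4)[OF \<nu> s'(2)] by simp
  finally have "\<beta> U V < \<beta> K L + \<epsilon>"
    using 1 by simp
  with KU LV show ?thesis by blast
qed

text \<open>Finite comparison bounds the series by \<open>\<beta> \<delta> \<theta>\<close>. The
  converse follows the classical compactness proof for Lebesgue measure.\<close>

lemma countably_additive:
  assumes d: "\<And>i. d i \<in> sets (borel_of X)" and t: "\<And>i. t i \<in> sets (borel_of Y)"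
    and \<delta>: "\<delta> \<in> sets (borel_of X)" and \<theta>: "\<theta> \<in> sets (borel_of Y)"
    and disj: "disjoint_family (\<lambda>i::nat. d i \<times> t i)" and un: "(\<Union>i. d i \<times> t i) = \<delta> \<times> \<theta>"
  shows "(\<lambda>i. \<beta> (d i) (t i)) sums \<beta> \<delta> \<theta>"
proof -
  have le: "(\<Sum>i<n. \<beta> (d i) (t i)) \<le> \<beta> \<delta> \<theta>" for n
    using un by (intro sum_rectangles_le d t \<delta> \<theta> disj) auto
  have summ: "summable (\<lambda>i. \<beta> (d i) (t i))"
    by (rule summableI_nonneg_bounded[OF nonneg[OF d t] le])
  have "\<beta> \<delta> \<theta> \<le> (\<Sum>i. \<beta> (d i) (t i))"
  proof (rule field_le_epsilon)
    fix \<epsilon> :: real assume "\<epsilon> > 0"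
    then have \<epsilon>2: "\<epsilon> / 2 > 0" by simp
    \<comment> \<open>Half of \<epsilon> shrinks the target to a closed, hence compact, rectangle;
      the other half, in shares \<open>\<epsilon> / 2 * (1 / 2) ^ Suc i\<close>, enlarges the pieces
      to open ones.\<close>
    obtain K L where KL: "closedin X K" "K \<subseteq> \<delta>" "closedin Y L" "L \<subseteq> \<theta>" "\<beta> \<delta> \<theta> < \<beta> K L + \<epsilon> / 2"
    proof -
      obtain K U L V where *: "closedin X K" "openin X U" "K \<subseteq> \<delta>" "\<delta> \<subseteq> U"
        "closedin Y L" "openin Y V" "L \<subseteq> \<theta>" "\<theta> \<subseteq> V" "\<beta> U V < \<beta> K L + \<epsilon> / 2"
        using approx[OF \<delta> \<theta> \<epsilon>2] by blast
      moreover have "\<beta> \<delta> \<theta> \<le> \<beta> U V"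
        using * by (intro mono \<delta> \<theta> openin_borel_of)
      ultimately show thesis
        by (intro that[of K L]) auto
    qed
    have "\<exists>U V. openin X U \<and> d i \<subseteq> U \<and> openin Y V \<and> t i \<subseteq> V \<and>
        \<beta> U V \<le> \<beta> (d i) (t i) + \<epsilon> / 2 * (1 / 2) ^ Suc i" for i
    proof -
      have "\<epsilon> / 2 * (1 / 2) ^ Suc i > 0"
        using \<epsilon>2 by simp
      from approx[OF d[of i] t[of i] this] obtain K U L V where *: "closedin X K" "openin X U" "K \<subseteq> d i" "d i \<subseteq> U"
        "closedin Y L" "openin Y V" "L \<subseteq> t i" "t i \<subseteq> V" "\<beta> U V < \<beta> K L + \<epsilon> / 2 * (1 / 2) ^ Suc i"
        by blast
      moreover have "\<beta> K L \<le> \<beta> (d i) (t i)"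
        using * by (intro mono d t closedin_borel_of)
      ultimately show ?thesis
        by (intro exI[of _ U] exI[of _ V]) auto
    qed
    then obtain U V where U: "\<And>i. openin X (U i)" "\<And>i. d i \<subseteq> U i"
      and V: "\<And>i. openin Y (V i)" "\<And>i. t i \<subseteq> V i"
      and UV: "\<And>i. \<beta> (U i) (V i) \<le> \<beta> (d i) (t i) + \<epsilon> / 2 * (1 / 2) ^ Suc i"
      by metis
    have cpt: "compactin (prod_topology X Y) (K \<times> L)"
      using KL X Y by (auto simp: compactin_Times closedin_compact_space)
    have op: "openin (prod_topology X Y) (U i \<times> V i)" for i
      using U V by (simp add: openin_prod_Times_iff)
    have cov: "K \<times> L \<subseteq> (\<Union>i. U i \<times> V i)"
    proof -
      have "K \<times> L \<subseteq> (\<Union>i. d i \<times> t i)"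
        using KL unfolding un by blast
      also have "\<dots> \<subseteq> (\<Union>i. U i \<times> V i)"
        using U V by (intro UN_mono Sigma_mono) auto
      finally show ?thesis .
    qed
    have "\<exists>\<F>. finite \<F> \<and> \<F> \<subseteq> range (\<lambda>i. U i \<times> V i) \<and> K \<times> L \<subseteq> \<Union>\<F>"
      by (rule compactinD[OF cpt _ cov]) (use op in auto)
    then obtain \<F> where \<F>: "finite \<F>" "\<F> \<subseteq> range (\<lambda>i. U i \<times> V i)" "K \<times> L \<subseteq> \<Union>\<F>"
      by auto
    from finite_subset_image[OF \<F>(1,2)] \<F>(3)
    obtain F where F: "finite F" "K \<times> L \<subseteq> (\<Union>i\<in>F. U i \<times> V i)"
      by auto
    then obtain n where "F \<subseteq> {..<n}"
      using finite_nat_iff_bounded by blast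
    with F have "K \<times> L \<subseteq> (\<Union>i<n. U i \<times> V i)"
      by blast
    then have "\<beta> K L \<le> (\<Sum>i<n. \<beta> (U i) (V i))"
      by (intro le_sum_rectangles openin_borel_of closedin_borel_of U V KL)
    also have "\<dots> \<le> (\<Sum>i<n. \<beta> (d i) (t i)) + (\<Sum>i<n. \<epsilon> / 2 * (1 / 2) ^ Suc i)"
      unfolding sum.distrib[symmetric] by (intro sum_mono UV)
    also have "\<dots> \<le> (\<Sum>i. \<beta> (d i) (t i)) + \<epsilon> / 2"
    proof (rule add_mono)
      show "(\<Sum>i<n. \<beta> (d i) (t i)) \<le> (\<Sum>i. \<beta> (d i) (t i))"
        using nonneg[OF d t] by (intro sum_le_suminf summ) auto
      have sums: "(\<lambda>n. \<epsilon> / 2 * (1 / 2) ^ Suc n) sums (\<epsilon> / 2 * 1)"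
        by (intro sums_mult power_half_series)
      show "(\<Sum>i<n. \<epsilon> / 2 * (1 / 2) ^ Suc i) \<le> \<epsilon> / 2"
        using sum_le_suminf[OF sums_summable[OF sums], of "{..<n}"] sums_unique[OF sums] \<epsilon>2 by simp
    qed
    finally show "\<beta> \<delta> \<theta> \<le> (\<Sum>i. \<beta> (d i) (t i)) + \<epsilon>"
      using KL by simp
  qed
  moreover have "(\<Sum>i. \<beta> (d i) (t i)) \<le> \<beta> \<delta> \<theta>"
    by (rule suminf_le_const[OF summ le])
  ultimately show ?thesis
    using summable_sums[OF summ] by simp
qed

lemma extension:
  "\<exists>\<mu>. finite_measure \<mu> \<and> sets \<mu> = sets (borel_of X \<Otimes>\<^sub>M borel_of Y) \<and>
     (\<forall>\<delta>\<in>sets (borel_of X). \<forall>\<theta>\<in>sets (borel_of Y). measure \<mu> (\<delta> \<times> \<theta>) = \<beta> \<delta> \<theta>)"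
proof -
  let ?M = "borel_of X" and ?N = "borel_of Y"
  define P where "P a b \<longleftrightarrow> a \<in> sets ?M \<and> b \<in> sets ?N" for a b
  define \<mu> where "\<mu> = extend_measure (space ?M \<times> space ?N) {(a, b). P a b} (\<lambda>(a, b). a \<times> b)
    (\<lambda>(a, b). ennreal (\<beta> a b))"
  have img: "(\<lambda>(a, b). a \<times> b) ` {(a, b). P a b} = {a \<times> b |a b. a \<in> sets ?M \<and> b \<in> sets ?N}"
    by (auto simp: P_def image_def)
  have sets: "sets \<mu> = sets (?M \<Otimes>\<^sub>M ?N)"
    unfolding \<mu>_def sets_pair_measure
    by (subst sets_extend_measure) (use pair_measure_closed[of ?M ?N] in \<open>simp_all only: img\<close>)
  have em: "emeasure \<mu> (a \<times> b) = ennreal (\<beta> a b)" if "P a b" for a b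
  proof (rule extend_measure_caratheodory_pair[OF \<mu>_def that])
    show "semiring_of_sets (space ?M \<times> space ?N) {a \<times> b |a b. P a b}"
      unfolding P_def by (rule semiring_of_rectangles)
    have e: "\<beta> a b = 0" if "P a b" "a \<times> b = {}" for a b
      using that empty by (auto simp: P_def)
    then show "ennreal (\<beta> a b) = 0" if "P a b" "a \<times> b = {}" for a b
      using that by simp
    \<comment> \<open>A nonempty rectangle determines both sides; an empty one has many
      descriptions, all of value 0.\<close>
    show "ennreal (\<beta> i j) = ennreal (\<beta> k l)" if "P i j" "P k l" "i \<times> j = k \<times> l" for i j k l
      using that e[of i j] e[of k l] by (auto simp: times_eq_iff)
    show "(\<Sum>n. ennreal (\<beta> (A n) (B n))) = ennreal (\<beta> j k)"
      if "\<And>n. P (A n) (B n)" "P j k" "disjoint_family (\<lambda>n. A n \<times> B n)" "(\<Union>i. A i \<times> B i) = j \<times> k"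
      for A :: "nat \<Rightarrow> 'x set" and B :: "nat \<Rightarrow> 'y set" and j k
    proof -
      have "(\<lambda>i. \<beta> (A i) (B i)) sums \<beta> j k"
        using that by (intro countably_additive) (auto simp: P_def)
      then show ?thesis
        using that nonneg
        by (intro suminf_ennreal_eq) (auto simp: P_def)
    qed
  qed simp
  have "finite_measure \<mu>"
  proof
    have "space \<mu> = space ?M \<times> space ?N"
      using sets_eq_imp_space_eq[OF sets] by (simp add: space_pair_measure)
    then show "emeasure \<mu> (space \<mu>) \<noteq> \<infinity>"
      using em[of "space ?M" "space ?N"] by (simp add: P_def)
  qed
  moreover have "measure \<mu> (\<delta> \<times> \<theta>) = \<beta> \<delta> \<theta>" if "\<delta> \<in> sets ?M" "\<theta> \<in> sets ?N" for \<delta> \<theta>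
    using em[of \<delta> \<theta>] that nonneg[OF that] by (simp add: P_def measure_def)
  ultimately show ?thesis
    using sets by blast
qed

end

section \<open>Quantum probability measures\<close>

lemma represents_from_sums:
  assumes nonneg: "\<And>A. A \<in> sets M \<Longrightarrow> 0 \<le> m A"
    and sums: "\<And>A. range A \<subseteq> sets M \<Longrightarrow> disjoint_family A \<Longrightarrow> (\<lambda>k::nat. m (A k)) sums m (\<Union>k. A k)"
  shows "\<exists>\<mu>. represents M m \<mu>"
proof -
  define \<mu> where "\<mu> = measure_of (space M) (sets M) (\<lambda>A. ennreal (m A))"
  \<comment> \<open>A constant series converges only if the constant is 0.\<close>
  have "m {} = 0"
    using sums[of "\<lambda>_. {}"] sums_summable[of "\<lambda>_::nat. m {}"]
    by (auto simp: disjoint_family_on_def summable_const_iff)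
  have em: "emeasure \<mu> A = ennreal (m A)" if "A \<in> sets M" for A
    unfolding \<mu>_def
  proof (rule emeasure_measure_of_sigma[OF sets.sigma_algebra_axioms _ _ that])
    show "positive (sets M) (\<lambda>A. ennreal (m A))"
      by (simp add: positive_def \<open>m {} = 0\<close>)
    show "countably_additive (sets M) (\<lambda>A. ennreal (m A))"
      unfolding countably_additive_def
      by (auto intro!: suminf_ennreal_eq nonneg sums)
  qed
  have s: "sets \<mu> = sets M" "space \<mu> = space M"
    by (simp_all add: \<mu>_def)
  have "finite_measure \<mu>"
    by (rule finite_measureI) (simp add: s em)
  then show ?thesis
    using s em nonneg by (auto simp: represents_def measure_def)
qed

lemma represents_sums:
  assumes "represents M m \<mu>" "range A \<subseteq> sets M" "disjoint_family A"
  shows "(\<lambda>k::nat. m (A k)) sums m (\<Union>k. A k)"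
proof -
  have "A k \<in> sets M" for k
    using assms(2) by auto
  moreover from this have "(\<Union>k. A k) \<in> sets M"
    by blast
  ultimately show ?thesis
    using finite_measure.finite_measure_UNION[OF representsD(1)[OF assms(1)] _ assms(3)]
      representsD(2,4)[OF assms(1)] assms(2) by auto
qed

text \<open>A quantum probability measure seen through its quadratic forms, with finite scalar
  measures in place of the weak* clause. The notions agree by
  \<open>weak_qpm.quantum_prob_measure\<close> and
  \<open>quantum_prob_measure_imp_weak_qpm\<close>.\<close>

locale weak_qpm =
  fixes M :: "'a measure" and E :: "'a set \<Rightarrow> 'h::chilbert_space \<Rightarrow> 'h"
  assumes pos: "\<And>\<delta>. \<delta> \<in> sets M \<Longrightarrow> positive_operator (E \<delta>)"
    and total: "E (space M) = id"
    and rep: "\<And>h. \<exists>\<mu>. represents M (\<lambda>\<delta>. inner h (E \<delta> h)) \<mu>"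
begin

lemma add:
  assumes "\<delta> \<in> sets M" "\<theta> \<in> sets M" "\<delta> \<inter> \<theta> = {}"
  shows "E (\<delta> \<union> \<theta>) = (\<lambda>x. E \<delta> x + E \<theta> x)"
proof (rule positive_operator_eqI)
  fix x
  obtain \<mu> where \<mu>: "represents M (\<lambda>\<delta>. inner x (E \<delta> x)) \<mu>"
    using rep by blast
  show "inner x (E (\<delta> \<union> \<theta>) x) = inner x (E \<delta> x + E \<theta> x)"
    using finite_measure.finite_measure_Union[OF representsD(1)[OF \<mu>], of \<delta> \<theta>] assms
    by (simp add: representsD[OF \<mu>] inner_add_right)
qed (use assms in \<open>auto intro!: pos positive_operator_add\<close>)

lemma compl:
  assumes "\<delta> \<in> sets M"
  shows "E (space M - \<delta>) = (\<lambda>x. x - E \<delta> x)"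
proof
  fix x
  have "\<delta> \<union> (space M - \<delta>) = space M"
    using sets.sets_into_space[OF assms] by auto
  then have "x = E \<delta> x + E (space M - \<delta>) x"
    using fun_cong[OF add[of \<delta> "space M - \<delta>"], of x] assms by (simp add: total)
  then show "E (space M - \<delta>) x = x - E \<delta> x"
    by (simp add: algebra_simps)
qed

lemma effect: "\<delta> \<in> sets M \<Longrightarrow> effect (E \<delta>)"
  using compl[of \<delta>] pos[of \<delta>] pos[of "space M - \<delta>"] by (simp add: effect_def sets.compl_sets)

lemma empty: "E {} = (\<lambda>_. 0)"
  using compl[of "space M"] by (simp add: total)

lemma finite_Union:
  assumes "range A \<subseteq> sets M" "disjoint_family A"
  shows "E (\<Union>k<n::nat. A k) x = (\<Sum>k<n. E (A k) x)"
proof (induction n)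
  case (Suc n)
  have "A k \<in> sets M" for k
    using assms(1) by auto
  moreover have "A k \<inter> A n = {}" if "k < n" for k
    using that by (intro disjoint_family_onD[OF assms(2)]) auto
  then have "(\<Union>k<n. A k) \<inter> A n = {}"
    by blast
  ultimately have "E ((\<Union>k<n. A k) \<union> A n) = (\<lambda>x. E (\<Union>k<n. A k) x + E (A n) x)"
    by (intro add) auto
  moreover have "(\<Union>k<Suc n. A k) = (\<Union>k<n. A k) \<union> A n"
    by (auto simp: lessThan_Suc)
  ultimately show ?case
    using Suc by simp
qed (simp add: empty)

text \<open>The error of a partial sum is the value of \<open>E\<close> on the part not yet covered,
  hence an effect; this opens tails to the norm inequalities for effects.\<close>

lemma remainder:
  assumes A: "range A \<subseteq> sets M" "disjoint_family A"
  obtains B where "B \<in> sets M" "\<And>x. E (\<Union>k. A k) x - (\<Sum>k<n::nat. E (A k) x) = E B x"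
proof -
  have s: "A k \<in> sets M" for k
    using A(1) by auto
  let ?B = "(\<Union>k. A k) - (\<Union>k<n. A k)"
  have "E (?B \<union> (\<Union>k<n. A k)) = (\<lambda>x. E ?B x + E (\<Union>k<n. A k) x)"
    using s by (intro add) auto
  moreover have "?B \<union> (\<Union>k<n. A k) = (\<Union>k. A k)"
    by auto
  ultimately have "E (\<Union>k. A k) x - (\<Sum>k<n. E (A k) x) = E ?B x" for x
    by (simp add: finite_Union[OF A])
  then show thesis
    using s by (intro that[of ?B]) auto
qed

lemma sums:
  assumes A: "range A \<subseteq> sets M" "disjoint_family A"
  shows "(\<lambda>k::nat. E (A k) x) sums E (\<Union>k. A k) x"
proof -
  obtain \<mu> where \<mu>: "represents M (\<lambda>\<delta>. inner x (E \<delta> x)) \<mu>"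
    using rep by blast
  let ?r = "\<lambda>n. E (\<Union>k. A k) x - (\<Sum>k<n. E (A k) x)"
  have "(norm (?r n))\<^sup>2 \<le> inner x (?r n)" for n
  proof -
    obtain B where "B \<in> sets M" "?r n = E B x"
      using remainder[OF A, of n] by metis
    then show ?thesis
      using effect_norm_square_le[OF effect, of B x] by simp
  qed
  moreover have "(\<lambda>n. inner x (?r n)) \<longlonglongrightarrow> 0"
    using tendsto_diff[OF tendsto_const represents_sums[OF \<mu> A, unfolded sums_def],
        of "inner x (E (\<Union>k. A k) x)"]
    by (simp add: inner_diff_right inner_sum_right)
  ultimately have "(\<lambda>n. (norm (?r n))\<^sup>2) \<longlonglongrightarrow> 0"
    by (intro Lim_null_comparison[of "\<lambda>n. (norm (?r n))\<^sup>2"]) auto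
  then have "(\<lambda>n. norm (?r n)) \<longlonglongrightarrow> 0"
    using tendsto_real_sqrt by fastforce
  then have "?r \<longlonglongrightarrow> 0"
    by (rule tendsto_norm_zero_cancel)
  from tendsto_diff[OF tendsto_const this, of "E (\<Union>k. A k) x"] show ?thesis
    by (simp add: sums_def)
qed

lemma quantum_prob_measure: "quantum_prob_measure M E"
  unfolding quantum_prob_measure_def
proof (intro conjI ballI allI impI pos total)
  fix A :: "nat \<Rightarrow> 'a set"
  assume A: "range A \<subseteq> sets M" "disjoint_family A"
  have s: "A k \<in> sets M" for k
    using A(1) by auto
  show "limitin weak_star_topology (\<lambda>n h. \<Sum>k<n. E (A k) h) (E (\<Union>k. A k)) sequentially"
  proof (rule strong_limit_imp_weak_star_limit)
    show "bounded_clinear (E (\<Union>k. A k))" "\<And>n. bounded_clinear (\<lambda>h. \<Sum>k<n. E (A k) h)"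
      using s by (auto intro!: positive_operator_bounded_clinear pos positive_operator_sum)
    show "norm ((\<Sum>k<n. E (A k) x) - E (\<Union>k. A k) x) \<le> norm x" for n x
    proof -
      obtain B where "B \<in> sets M" "E (\<Union>k. A k) x - (\<Sum>k<n. E (A k) x) = E B x"
        using remainder[OF A, of n] by metis
      then show ?thesis
        using effect_norm_le[OF effect, of B x] by (simp add: norm_minus_commute)
    qed
    show "(\<lambda>n. \<Sum>k<n. E (A k) x) \<longlonglongrightarrow> E (\<Union>k. A k) x" for x
      using sums[OF A] by (simp add: sums_def)
  qed
qed

end

lemma quantum_prob_measure_imp_weak_qpm:
  assumes E: "quantum_prob_measure M E"
  shows "weak_qpm M E"
proof
  show pos: "positive_operator (E \<delta>)" if "\<delta> \<in> sets M" for \<delta>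
    using E that by (simp add: quantum_prob_measure_def)
  show "E (space M) = id"
    using E by (simp add: quantum_prob_measure_def)
  fix h
  show "\<exists>\<mu>. represents M (\<lambda>\<delta>. inner h (E \<delta> h)) \<mu>"
  proof (rule represents_from_sums)
    show "0 \<le> inner h (E \<delta> h)" if "\<delta> \<in> sets M" for \<delta>
      by (rule positive_operator_nonneg[OF pos[OF that]])
    fix A :: "nat \<Rightarrow> _" assume "range A \<subseteq> sets M" "disjoint_family A"
    then have "limitin weak_star_topology (\<lambda>n h. \<Sum>k<n. E (A k) h) (E (\<Union>k. A k)) sequentially"
      using E by (simp add: quantum_prob_measure_def)
    from tendsto_Re[OF weak_star_limit_imp_weak_limit[OF this, of h]]
    show "(\<lambda>k. inner h (E (A k) h)) sums inner h (E (\<Union>k. A k) h)"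
      by (simp add: sums_def inner_eq_Re_cinner cinner.sum_right)
  qed
qed

text \<open>Dynkin's \<pi>-\<lambda> theorem, with rectangles as the intersection-stable generator.
  It serves uniqueness, existence and idempotence alike.\<close>

lemma product_induct [consumes 1, case_names rectangle empty compl union]:
  assumes "\<gamma> \<in> sets (M \<Otimes>\<^sub>M N)"
    and "\<And>\<delta> \<theta>. \<delta> \<in> sets M \<Longrightarrow> \<theta> \<in> sets N \<Longrightarrow> P (\<delta> \<times> \<theta>)"
    and "P {}"
    and "\<And>A. A \<in> sets (M \<Otimes>\<^sub>M N) \<Longrightarrow> P A \<Longrightarrow> P (space (M \<Otimes>\<^sub>M N) - A)"
    and "\<And>A. disjoint_family A \<Longrightarrow> range A \<subseteq> sets (M \<Otimes>\<^sub>M N) \<Longrightarrow> (\<And>i. P (A i)) \<Longrightarrow> P (\<Union>i::nat. A i)"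
  shows "P \<gamma>"
  using Int_stable_pair_measure_generator pair_measure_closed
    assms(1)[unfolded sets_pair_measure]
proof (induction rule: sigma_sets_induct_disjoint)
  case (basic A)
  then show ?case using assms(2) by auto
next
  case (compl A)
  then show ?case using assms(4) by (simp add: sets_pair_measure space_pair_measure)
next
  case (union A)
  then show ?case using assms(5) by (simp add: sets_pair_measure)
qed (rule assms(3))

lemma weak_qpm_eqI:
  assumes G: "weak_qpm (M \<Otimes>\<^sub>M N) G" and G': "weak_qpm (M \<Otimes>\<^sub>M N) G'"
    and eq: "\<And>\<delta> \<theta>. \<delta> \<in> sets M \<Longrightarrow> \<theta> \<in> sets N \<Longrightarrow> G (\<delta> \<times> \<theta>) = G' (\<delta> \<times> \<theta>)"
    and "\<gamma> \<in> sets (M \<Otimes>\<^sub>M N)"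
  shows "G \<gamma> = G' \<gamma>"
  using assms(4)
proof (induction rule: product_induct)
  case (rectangle \<delta> \<theta>)
  then show ?case by (rule eq)
next
  case empty
  show ?case by (simp add: weak_qpm.empty[OF G] weak_qpm.empty[OF G'])
next
  case (compl A)
  then show ?case by (simp add: weak_qpm.compl[OF G] weak_qpm.compl[OF G'])
next
  case (union A)
  show ?case
    using sums_unique2[OF weak_qpm.sums[OF G union(2,1)]] weak_qpm.sums[OF G' union(2,1)] union(3)
    by (simp add: fun_eq_iff)
qed

section \<open>Existence of the product of two commuting measures\<close>

locale commuting_qpm =
  E: weak_qpm "borel_of X" E + F: weak_qpm "borel_of Y" F
  for X :: "'x topology" and Y :: "'y topology"
    and E :: "'x set \<Rightarrow> 'h::chilbert_space \<Rightarrow> 'h" and F +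
  assumes comm: "commuting_ranges (borel_of X) (borel_of Y) E F"
begin

lemma commute:
  assumes "\<delta> \<in> sets (borel_of X)" "\<theta> \<in> sets (borel_of Y)"
  shows "E \<delta> \<circ> F \<theta> = F \<theta> \<circ> E \<delta>"
  using comm assms by (auto simp: commuting_ranges_def)

lemma totals: "E (topspace X) = id" "F (topspace Y) = id"
  using E.total F.total by simp_all

lemma compose_positive:
  assumes "\<delta> \<in> sets (borel_of X)" "\<theta> \<in> sets (borel_of Y)"
  shows "positive_operator (E \<delta> \<circ> F \<theta>)"
  using assms by (intro commuting_effects_compose_positive E.effect F.effect commute)

text \<open>In the first variable, strong additivity of \<open>E\<close> is used at the vector
  \<open>F \<theta> h\<close>; in the second, the bounded operator \<open>E \<delta>\<close> passes
  through the series for \<open>F\<close>. Commutation enters through nonnegativity.\<close>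

lemma bimeasure: "bimeasure (borel_of X) (borel_of Y) (\<lambda>\<delta> \<theta>. inner h (E \<delta> (F \<theta> h)))"
proof
  have nonneg: "0 \<le> inner h (E \<delta> (F \<theta> h))" if "\<delta> \<in> sets (borel_of X)" "\<theta> \<in> sets (borel_of Y)" for \<delta> \<theta>
    using positive_operator_nonneg[OF compose_positive[OF that], of h] by simp
  show "\<exists>\<mu>. represents (borel_of X) (\<lambda>\<delta>. inner h (E \<delta> (F \<theta> h))) \<mu>"
    if "\<theta> \<in> sets (borel_of Y)" for \<theta>
    by (intro represents_from_sums nonneg that bounded_linear.sums[OF bounded_linear_inner_right] E.sums)
  show "\<exists>\<nu>. represents (borel_of Y) (\<lambda>\<theta>. inner h (E \<delta> (F \<theta> h))) \<nu>"
    if "\<delta> \<in> sets (borel_of X)" for \<delta>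
    by (intro represents_from_sums nonneg that bounded_linear.sums[OF bounded_linear_inner_right]
        bounded_linear.sums[OF bounded_clinearD(1)[OF positive_operator_bounded_clinear[OF E.pos[OF that]]]]
        F.sums)
qed

text \<open>The scalar measures \<open>\<mu> h\<close> extend \<open>\<delta> \<times> \<theta> \<mapsto> \<langle>h, E \<delta> F \<theta> h\<rangle>\<close>. That \<open>h \<mapsto> \<mu> h \<gamma>\<close> is the
  quadratic form of an operator is a property of \<open>\<gamma>\<close> which holds for rectangles and is stable
  under complements and disjoint unions.\<close>

lemma product_exists:
  assumes X: "second_countable X" "regular_space X" "compact_space X"
    and Y: "second_countable Y" "regular_space Y" "compact_space Y"
  shows "\<exists>G. is_product_qpm (borel_of X) (borel_of Y) E F G"
proof -
  let ?M = "borel_of X" and ?N = "borel_of Y"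
  let ?P = "?M \<Otimes>\<^sub>M ?N"
  have "borel_bimeasure X Y (\<lambda>\<delta> \<theta>. inner h (E \<delta> (F \<theta> h)))" for h
    using bimeasure X Y by (intro borel_bimeasure.intro borel_bimeasure_axioms.intro)
  note borel_bimeasure.extension[OF this]
  then obtain \<mu> where fin: "\<And>h. finite_measure (\<mu> h)" and sets: "\<And>h. sets (\<mu> h) = sets ?P"
    and rect: "\<And>h \<delta> \<theta>. \<delta> \<in> sets ?M \<Longrightarrow> \<theta> \<in> sets ?N \<Longrightarrow> measure (\<mu> h) (\<delta> \<times> \<theta>) = inner h (E \<delta> (F \<theta> h))"
    by metis
  have space: "space (\<mu> h) = space ?P" for h
    by (rule sets_eq_imp_space_eq[OF sets])
  have total: "measure (\<mu> h) (space ?P) = inner h h" for h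
    unfolding space_pair_measure
    by (subst rect) (simp_all add: totals)
  have le_total: "measure (\<mu> h) \<gamma> \<le> inner h h" for h \<gamma>
    using finite_measure.bounded_measure[OF fin, of h \<gamma>] by (simp add: space total)
  have "\<exists>T. effect T \<and> (\<forall>h. inner h (T h) = measure (\<mu> h) \<gamma>)" if "\<gamma> \<in> sets ?P" for \<gamma>
    using that
  proof (induction rule: product_induct)
    case (rectangle \<delta> \<theta>)
    then have "effect (E \<delta> \<circ> F \<theta>)"
      using le_total[of _ "\<delta> \<times> \<theta>"] by (intro effectI compose_positive) (simp_all add: rect)
    then show ?case
      using rectangle by (intro exI[of _ "E \<delta> \<circ> F \<theta>"] conjI allI) (simp_all add: rect o_def)
  next
    case empty
    have "effect (\<lambda>_::'h. 0 :: 'h)"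
      using E.effect[of "{}"] by (simp add: E.empty)
    then show ?case by auto
  next
    case (compl A)
    then obtain T where T: "effect T" "\<And>h. inner h (T h) = measure (\<mu> h) A"
      by blast
    have "inner h (h - T h) = measure (\<mu> h) (space ?P - A)" for h
      using finite_measure.finite_measure_compl[OF fin, of A h] compl(1)
      by (simp add: inner_diff_right T(2) space sets total)
    then show ?case
      using effect_compl[OF T(1)] by blast
  next
    case (union A)
    then obtain T where T: "\<And>k. effect (T k)" "\<And>k h. inner h (T k h) = measure (\<mu> h) (A k)"
      by metis
    have s: "(\<lambda>k. inner h (T k h)) sums measure (\<mu> h) (\<Union>k. A k)" for h
      unfolding T(2) using union by (intro finite_measure.finite_measure_UNION[OF fin]) (simp_all add: sets)
    \<comment> \<open>The quadratic form of a partial sum is at most the measure of the union, so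
      partial sums stay below \<open>I\<close> and \<open>effect_sums\<close> supplies a strong
      limit.\<close>
    have "effect (\<lambda>x. \<Sum>k<n. T k x)" for n
    proof (rule effectI[OF positive_operator_sum[OF effect_positive[OF T(1)]]])
      fix h
      have "(\<Sum>k<n. inner h (T k h)) \<le> measure (\<mu> h) (\<Union>k. A k)"
        using sum_le_suminf[OF sums_summable[OF s], of "{..<n}"] sums_unique[OF s]
        by (simp add: T(2))
      then show "inner h (\<Sum>k<n. T k h) \<le> inner h h"
        using le_total[of h "\<Union>k. A k"] by (simp add: inner_sum_right)
    qed
    then obtain L where L: "effect L" "\<And>x. (\<lambda>k. T k x) sums L x"
      using effect_sums[of T] effect_positive[OF T(1)] by blast
    have "inner h (L h) = measure (\<mu> h) (\<Union>k. A k)" for h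
      by (rule sums_unique2[OF bounded_linear.sums[OF bounded_linear_inner_right L(2)] s])
    with L(1) show ?case by blast
  qed
  then obtain T where T: "\<And>\<gamma>. \<gamma> \<in> sets ?P \<Longrightarrow> effect (T \<gamma>)"
    "\<And>\<gamma> h. \<gamma> \<in> sets ?P \<Longrightarrow> inner h (T \<gamma> h) = measure (\<mu> h) \<gamma>"
    by metis
  \<comment> \<open>\<open>T\<close> is merely chosen set by set; its quadratic forms pin it down.
    The restriction meets the extensionality demanded of a product.\<close>
  define G where "G = restrict T (sets ?P)"
  have G_rect: "G (\<delta> \<times> \<theta>) = E \<delta> \<circ> F \<theta>" if "\<delta> \<in> sets ?M" "\<theta> \<in> sets ?N" for \<delta> \<theta>
  proof (rule positive_operator_eqI[OF _ compose_positive[OF that]])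
    have s: "\<delta> \<times> \<theta> \<in> sets ?P"
      using that by (rule pair_measureI)
    show "positive_operator (G (\<delta> \<times> \<theta>))"
      using effect_positive[OF T(1)[OF s]] s by (simp add: G_def)
    show "inner h (G (\<delta> \<times> \<theta>) h) = inner h ((E \<delta> \<circ> F \<theta>) h)" for h
      using T(2)[OF s] rect[OF that] s by (simp add: G_def)
  qed
  have "weak_qpm ?P G"
  proof
    show "positive_operator (G \<gamma>)" if "\<gamma> \<in> sets ?P" for \<gamma>
      using effect_positive[OF T(1)[OF that]] that by (simp add: G_def)
    show "G (space ?P) = id"
      unfolding space_pair_measure
      by (subst G_rect) (simp_all add: totals)
    show "\<exists>\<nu>. represents ?P (\<lambda>\<gamma>. inner h (G \<gamma> h)) \<nu>" for h
      using fin[of h] T(2) by (intro exI[of _ "\<mu> h"]) (simp add: represents_def sets G_def)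
  qed
  then have "is_product_qpm ?M ?N E F G"
    using G_rect by (auto simp: is_product_qpm_def weak_qpm.quantum_prob_measure G_def)
  then show ?thesis by blast
qed

end

text \<open>On a vector fixed by \<open>E \<theta>\<close>, the bound
  \<open>E (\<delta> \<union> \<theta>) \<le> I\<close> is already exhausted by
  \<open>E \<theta>\<close>, so the quadratic form of \<open>E \<delta>\<close> vanishes
  there.\<close>

lemma (in weak_qpm) idempotent_orthogonal:
  assumes s: "\<delta> \<in> sets M" "\<theta> \<in> sets M" "\<delta> \<inter> \<theta> = {}" and idem: "E \<theta> \<circ> E \<theta> = E \<theta>"
  shows "E \<delta> (E \<theta> x) = 0"
proof -
  let ?y = "E \<theta> x"
  have "inner ?y (E \<delta> ?y + E \<theta> ?y) \<le> inner ?y ?y"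
    using effect_le[OF effect[of "\<delta> \<union> \<theta>"], of ?y] s by (simp add: add)
  moreover have "E \<theta> ?y = ?y"
    using fun_cong[OF idem, of x] by simp
  ultimately have "inner ?y (E \<delta> ?y) \<le> 0"
    by (simp add: inner_add_right)
  then have "(norm (E \<delta> ?y))\<^sup>2 \<le> 0"
    using effect_norm_square_le[OF effect[OF s(1)], of ?y] by linarith
  then show ?thesis by simp
qed

text \<open>In the union step, idempotence of the pieces already forces them to annihilate one
  another, and a strong sum of mutually orthogonal projections is idempotent.\<close>

lemma product_idempotent:
  assumes G: "weak_qpm (M \<Otimes>\<^sub>M N) G"
    and rect: "\<And>\<delta> \<theta>. \<delta> \<in> sets M \<Longrightarrow> \<theta> \<in> sets N \<Longrightarrow> G (\<delta> \<times> \<theta>) \<circ> G (\<delta> \<times> \<theta>) = G (\<delta> \<times> \<theta>)"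
    and "\<gamma> \<in> sets (M \<Otimes>\<^sub>M N)"
  shows "G \<gamma> \<circ> G \<gamma> = G \<gamma>"
proof -
  interpret G: weak_qpm "M \<Otimes>\<^sub>M N" G
    by fact
  note lin = positive_operator_bounded_clinear[OF G.pos]
  show ?thesis
    using assms(3)
  proof (induction rule: product_induct)
    case (rectangle \<delta> \<theta>)
    then show ?case by (rule rect)
  next
    case empty
    show ?case by (simp add: G.empty fun_eq_iff)
  next
    case (compl A)
    have "G A (G A x) = G A x" for x
      using fun_cong[OF compl(2), of x] by simp
    then show ?case
      using compl(1) by (simp add: G.compl fun_eq_iff bounded_clinear_diff_apply[OF lin])
  next
    case (union A)
    have s: "A k \<in> sets (M \<Otimes>\<^sub>M N)" for k
      using union(2) by auto
    let ?L = "G (\<Union>k. A k)"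
    \<comment> \<open>In the series for \<open>?L x\<close> every term but the \<open>j\<close>-th
      is annihilated by \<open>G (A j)\<close>.\<close>
    have absorb: "G (A j) (?L x) = G (A j) x" for j x
    proof -
      have "(\<lambda>k. G (A j) (G (A k) x)) sums G (A j) (?L x)"
        by (intro bounded_linear.sums[OF bounded_clinearD(1)[OF lin[OF s]]] G.sums union)
      moreover have "G (A j) (G (A k) x) = (if k = j then G (A j) x else 0)" for k
      proof (cases "k = j")
        case True
        then show ?thesis using fun_cong[OF union(3)[of j], of x] by simp
      next
        case False
        then have "A j \<inter> A k = {}"
          using union(1) by (auto simp: disjoint_family_on_def)
        then show ?thesis
          using False by (simp add: G.idempotent_orthogonal[OF s s _ union(3)])
      qed
      ultimately have "(\<lambda>k. if k = j then G (A j) x else 0) sums G (A j) (?L x)"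
        by simp
      from sums_unique2[OF this sums_single[of j "\<lambda>_. G (A j) x"]] show ?thesis .
    qed
    show ?case
    proof
      fix x
      \<comment> \<open>The series for \<open>?L\<close> is evaluated at the vector
        \<open>?L x\<close>, where absorption turns each term back into
        \<open>G (A j) x\<close>.\<close>
      have "(\<lambda>j. G (A j) x) sums ?L (?L x)"
        using G.sums[OF union(2,1), of "?L x"] unfolding absorb .
      from sums_unique2[OF this G.sums[OF union(2,1)]] show "(?L \<circ> ?L) x = ?L x"
        by simp
    qed
  qed
qed

theorem theorem3p2:
  fixes X :: "'x topology" and Y :: "'y topology"
    and E :: "'x set \<Rightarrow> 'h::chilbert_space \<Rightarrow> 'h" and F :: "'y set \<Rightarrow> 'h \<Rightarrow> 'h"
  assumes "second_countable X" and "compact_space X" and "Hausdorff_space X"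
    and "second_countable Y" and "compact_space Y" and "Hausdorff_space Y"
    and "quantum_prob_measure (borel_of X) E"
    and "quantum_prob_measure (borel_of Y) F"
    and "commuting_ranges (borel_of X) (borel_of Y) E F"
  shows "(\<exists>!G. is_product_qpm (borel_of X) (borel_of Y) E F G) \<and>
    (spectral_measure (borel_of X) E \<and> spectral_measure (borel_of Y) F \<longrightarrow>
      (\<forall>G. is_product_qpm (borel_of X) (borel_of Y) E F G \<longrightarrow>
        spectral_measure (borel_of X \<Otimes>\<^sub>M borel_of Y) G))"
proof -
  let ?M = "borel_of X" and ?N = "borel_of Y"
  interpret commuting_qpm X Y E F
    using assms(7-9)
    by (intro commuting_qpm.intro commuting_qpm_axioms.intro quantum_prob_measure_imp_weak_qpm)
  \<comment> \<open>Regularity is the form of separation used when open sets are exhausted by closed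
    ones.\<close>
  have "regular_space X" "regular_space Y"
    using assms(2,3,5,6) by (auto intro: compact_Hausdorff_imp_regular_space)
  then have ex: "\<exists>G. is_product_qpm ?M ?N E F G"
    using assms(1,2,4,5) by (intro product_exists)
  have weak: "weak_qpm (?M \<Otimes>\<^sub>M ?N) G"
    and rect: "\<And>\<delta> \<theta>. \<delta> \<in> sets ?M \<Longrightarrow> \<theta> \<in> sets ?N \<Longrightarrow> G (\<delta> \<times> \<theta>) = E \<delta> \<circ> F \<theta>"
    and ext: "G \<in> extensional (sets (?M \<Otimes>\<^sub>M ?N))"
    if "is_product_qpm ?M ?N E F G" for G
    using that by (simp_all add: is_product_qpm_def quantum_prob_measure_imp_weak_qpm)
  have unique: "G = G'" if "is_product_qpm ?M ?N E F G" "is_product_qpm ?M ?N E F G'" for G G'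
  proof (rule extensionalityI[OF ext[OF that(1)] ext[OF that(2)]])
    fix \<gamma> assume \<gamma>: "\<gamma> \<in> sets (?M \<Otimes>\<^sub>M ?N)"
    show "G \<gamma> = G' \<gamma>"
    proof (rule weak_qpm_eqI[OF weak[OF that(1)] weak[OF that(2)] _ \<gamma>])
      fix \<delta> \<theta> assume "\<delta> \<in> sets ?M" "\<theta> \<in> sets ?N"
      then show "G (\<delta> \<times> \<theta>) = G' (\<delta> \<times> \<theta>)"
        using rect[OF that(1)] rect[OF that(2)] by metis
    qed
  qed
  have "spectral_measure (?M \<Otimes>\<^sub>M ?N) G"
    if sp: "spectral_measure ?M E" "spectral_measure ?N F" and G: "is_product_qpm ?M ?N E F G" for G
  proof -
    have idem: "G (\<delta> \<times> \<theta>) \<circ> G (\<delta> \<times> \<theta>) = G (\<delta> \<times> \<theta>)" if s: "\<delta> \<in> sets ?M" "\<theta> \<in> sets ?N" for \<delta> \<theta>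
    proof -
      have EF: "E \<delta> (E \<delta> x) = E \<delta> x" "F \<theta> (F \<theta> x) = F \<theta> x" "F \<theta> (E \<delta> x) = E \<delta> (F \<theta> x)" for x
        using sp s commute[OF s]
        by (auto simp: spectral_measure_def is_projection_def fun_eq_iff)
      show ?thesis
        by (simp add: rect[OF G s] EF fun_eq_iff)
    qed
    have "is_projection (G \<gamma>)" if \<gamma>: "\<gamma> \<in> sets (?M \<Otimes>\<^sub>M ?N)" for \<gamma>
    proof -
      note pos = weak_qpm.pos[OF weak[OF G] \<gamma>]
      \<comment> \<open>Self-adjointness comes with positivity, so being a projection reduces to
        idempotence.\<close>
      have "G \<gamma> \<circ> G \<gamma> = G \<gamma>"
        by (rule product_idempotent[OF weak[OF G] idem \<gamma>])
      then show ?thesis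
        unfolding is_projection_def
        using positive_operator_bounded_clinear[OF pos] positive_operator_symmetric[OF pos] by blast
    qed
    then show ?thesis
      using G by (simp add: spectral_measure_def is_product_qpm_def)
  qed
  with ex unique show ?thesis by blast
qed

end
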